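(* Let $N>1$ be an integer and let $A_1,\ldots,A_N,B$ be real-valued random variables such that $A_1,\ldots,A_N$ are i.i.d. Put $m(s)=\mathbb{E}\big[\sum_{i=1}^N|A_i|^s\big]=N\,\mathbb{E}[|A_1|^s]$ and $s_1=\sup\{s: m(s)<\infty\}$. Suppose that (i) $\log|A_1|$ is nonlattice; (ii) $\mathbb{P}[A_1>0]>0$ and $\mathbb{P}[A_1<0]>0$; (iii) $s_1>0$; (iv) there are $0<\gamma<\alpha<s_1$ such that $m(\gamma)=m(\alpha)=1$; (v) there is $\varepsilon>0$ such that $\mathbb{E}|B|^{\gamma+\varepsilon}<\infty$. Suppose that $R$ is a nontrivial solution of the equation in law $$R=_d\sum_{i=1}^N A_iR_i+B$$ such that $\mathbb{E}|R|^{\gamma+\varepsilon}<\infty$. Then $$\liminf_{t\to\infty}t^{\alpha}\,\mathbb{P}[R>t]>0\quad\text{and}\quad \liminf_{t\to\infty}t^{\alpha}\,\mathbb{P}[R<-t]>0.$$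
   Context: $=_d$ denotes equality in distribution. A real random variable $R$ is a solution of $R=_d\sum_{i=1}^N A_iR_i+B$ if the equality in law holds when $R_1,\ldots,R_N$ are i.i.d. copies of $R$ that are independent of the vector $(B,A_1,\ldots,A_N)$ ($B$ is allowed to depend on the $A_i$). A solution is nontrivial if it is not almost surely equal to a constant. "$\log|A_1|$ is nonlattice" means that the law of $\log|A_1|$ (on the event $A_1\ne0$) is not concentrated on any set of the form $a+h\mathbb{Z}$ with $a\in\mathbb{R}$, $h>0$. *)

theory Defs
  imports "HOL-Probability.Probability"
begin

text \<open>
  The expectation is taken in \<open>[0, \<infinity>]\<close>. Since \<open>0 powr s = 0\<close> for every \<open>s\<close>, a zero weight
  contributes nothing even when \<open>s \<le> 0\<close>. Such exponents do not influence \<open>smoothing_s1\<close>: with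
  either convention for \<open>0\<^sup>0\<close> the value at \<open>s = 0\<close> is at most \<open>N\<close>, so the supremum is at least \<open>0\<close>.
\<close>

definition smoothing_m :: "'a measure \<Rightarrow> nat \<Rightarrow> (nat \<Rightarrow> 'a \<Rightarrow> real) \<Rightarrow> real \<Rightarrow> ennreal" where
  "smoothing_m M N A s = (\<integral>\<^sup>+\<omega>. ennreal (\<Sum>i=1..N. \<bar>A i \<omega>\<bar> powr s) \<partial>M)"

definition smoothing_s1 :: "'a measure \<Rightarrow> nat \<Rightarrow> (nat \<Rightarrow> 'a \<Rightarrow> real) \<Rightarrow> ereal" where
  "smoothing_s1 M N A = (SUP s\<in>{s. smoothing_m M N A s < \<infinity>}. ereal s)"

definition nonlattice_log_abs :: "'a measure \<Rightarrow> ('a \<Rightarrow> real) \<Rightarrow> bool" where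
  "nonlattice_log_abs M X \<longleftrightarrow>
     \<not> (\<exists>a h. h > 0 \<and>
          (AE \<omega> in M. X \<omega> \<noteq> 0 \<longrightarrow> ln \<bar>X \<omega>\<bar> \<in> {a + h * real_of_int k | k. True}))"

definition nontrivial_rv :: "'b measure \<Rightarrow> ('b \<Rightarrow> real) \<Rightarrow> bool" where
  "nontrivial_rv M R \<longleftrightarrow> \<not> (\<exists>c. AE \<omega> in M. R \<omega> = c)"

text \<open>
  The i.i.d. copies of \<open>R\<close> independent of \<open>(B, A\<^sub>1, \<dots>, A\<^sub>N)\<close> are realised as \<open>R\<^sub>i (\<omega>, \<rho>) = R (\<rho> i)\<close>
  on the product of the space carrying the coefficients with \<open>N\<close> copies of the space carrying \<open>R\<close>.
  The lemma below shows that any other realisation gives the same notion.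
\<close>

definition smoothing_solution ::
  "'a measure \<Rightarrow> nat \<Rightarrow> (nat \<Rightarrow> 'a \<Rightarrow> real) \<Rightarrow> ('a \<Rightarrow> real) \<Rightarrow> 'b measure \<Rightarrow> ('b \<Rightarrow> real) \<Rightarrow> bool" where
  "smoothing_solution M N A B M' R \<longleftrightarrow>
     distr M' borel R =
     distr (M \<Otimes>\<^sub>M (\<Pi>\<^sub>M i\<in>{1..N}. M')) borel
       (\<lambda>(\<omega>, \<rho>). (\<Sum>i=1..N. A i \<omega> * R (\<rho> i)) + B \<omega>)"

lemma smoothing_solution_iff_realisation:
  fixes M :: "'a measure" and M' :: "'b measure" and K :: "'c measure"
    and N :: nat and A :: "nat \<Rightarrow> 'a \<Rightarrow> real" and A' R' :: "nat \<Rightarrow> 'c \<Rightarrow> real"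
  defines "I \<equiv> {1..N}"
  defines "V \<equiv> (borel :: real measure) \<Otimes>\<^sub>M (\<Pi>\<^sub>M i\<in>I. (borel :: real measure))"
  assumes "prob_space M" "prob_space M'" "prob_space K" and "N > 0"
    and A: "\<And>i. i \<in> I \<Longrightarrow> A i \<in> borel_measurable M" and B: "B \<in> borel_measurable M"
    and R: "R \<in> borel_measurable M'"
    and A': "\<And>i. i \<in> I \<Longrightarrow> A' i \<in> borel_measurable K" and B': "B' \<in> borel_measurable K"
    and coeff_law: "distr K V (\<lambda>\<omega>. (B' \<omega>, \<lambda>i\<in>I. A' i \<omega>)) =
                    distr M V (\<lambda>\<omega>. (B \<omega>, \<lambda>i\<in>I. A i \<omega>))"
    and R'_indep: "prob_space.indep_vars K (\<lambda>_. borel) R' I"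
    and R'_law: "\<And>i. i \<in> I \<Longrightarrow> distr K borel (R' i) = distr M' borel R"
    and indep: "distr K (V \<Otimes>\<^sub>M (\<Pi>\<^sub>M i\<in>I. borel)) (\<lambda>\<omega>. ((B' \<omega>, \<lambda>i\<in>I. A' i \<omega>), \<lambda>i\<in>I. R' i \<omega>)) =
                distr K V (\<lambda>\<omega>. (B' \<omega>, \<lambda>i\<in>I. A' i \<omega>)) \<Otimes>\<^sub>M
                distr K (\<Pi>\<^sub>M i\<in>I. borel) (\<lambda>\<omega>. \<lambda>i\<in>I. R' i \<omega>)"
  shows "smoothing_solution M N A B M' R \<longleftrightarrow>
         distr M' borel R = distr K borel (\<lambda>\<omega>. (\<Sum>i=1..N. A' i \<omega> * R' i \<omega>) + B' \<omega>)"
proof -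
  interpret M: prob_space M by fact
  interpret M': prob_space M' by fact
  interpret K: prob_space K by fact
  let ?P = "\<Pi>\<^sub>M i\<in>I. (borel :: real measure)" and ?Q = "\<Pi>\<^sub>M i\<in>I. M'"
  interpret Q: prob_space ?Q by (intro prob_space_PiM) (rule M'.prob_space_axioms)
  note [measurable] = A B R A' B'
  have R'[measurable]: "R' i \<in> borel_measurable K" if "i \<in> I" for i
    using R'_indep that by (auto simp: K.indep_vars_def)
  have I_ne: "I \<noteq> {}" and I_fin: "finite I" using \<open>N > 0\<close> by (auto simp: I_def)
  define F :: "(real \<times> (nat \<Rightarrow> real)) \<times> (nat \<Rightarrow> real) \<Rightarrow> real"
    where "F = (\<lambda>p. (\<Sum>i\<in>I. snd (fst p) i * snd p i) + fst (fst p))"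
  have F[measurable]: "F \<in> borel_measurable (V \<Otimes>\<^sub>M ?P)"
    unfolding F_def V_def by measurable
  define X where "X = (\<lambda>\<omega>. (B \<omega>, \<lambda>i\<in>I. A i \<omega>))"
  define X' where "X' = (\<lambda>\<omega>. (B' \<omega>, \<lambda>i\<in>I. A' i \<omega>))"
  define Y where "Y = (compose I R :: (nat \<Rightarrow> 'b) \<Rightarrow> _)"
  define Y' where "Y' = (\<lambda>\<omega>. \<lambda>i\<in>I. R' i \<omega>)"
  have X[measurable]: "X \<in> M \<rightarrow>\<^sub>M V" unfolding X_def V_def by measurable
  have X'[measurable]: "X' \<in> K \<rightarrow>\<^sub>M V" unfolding X'_def V_def by measurable
  have Y[measurable]: "Y \<in> ?Q \<rightarrow>\<^sub>M ?P" unfolding Y_def compose_def by measurable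
  have Y'[measurable]: "Y' \<in> K \<rightarrow>\<^sub>M ?P" unfolding Y'_def by measurable
  let ?L = "distr M' borel R"
  have "distr ?Q ?P Y = distr ?Q (\<Pi>\<^sub>M i\<in>I. ?L) Y"
    by (intro distr_cong sets_PiM_cong) auto
  also have "\<dots> = (\<Pi>\<^sub>M i\<in>I. distr M' ?L R)"
    unfolding Y_def by (rule distr_PiM_finite_prob_space')
      (auto intro: I_fin M'.prob_space_axioms M'.prob_space_distr R)
  also have "\<dots> = (\<Pi>\<^sub>M i\<in>I. ?L)"
    by (intro PiM_cong distr_cong) auto
  also have "\<dots> = distr K ?P Y'"
    using R'_indep K.indep_vars_iff_distr_eq_PiM'[where M' = "\<lambda>_. borel" and X = R', OF I_ne] R' R'_law
    by (auto simp: Y'_def intro!: PiM_cong)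
  finally have Y_law: "distr ?Q ?P Y = distr K ?P Y'" .
  interpret dY: prob_space "distr ?Q ?P Y" by (rule Q.prob_space_distr) measurable
  have "distr (M \<Otimes>\<^sub>M ?Q) (V \<Otimes>\<^sub>M ?P) (\<lambda>(\<omega>, \<rho>). (X \<omega>, Y \<rho>)) = distr M V X \<Otimes>\<^sub>M distr ?Q ?P Y"
    by (rule pair_measure_distr[symmetric]) (measurable, rule dY.sigma_finite_measure_axioms)
  also have "\<dots> = distr K V X' \<Otimes>\<^sub>M distr K ?P Y'"
    using coeff_law Y_law by (simp add: X_def X'_def)
  also have "\<dots> = distr K (V \<Otimes>\<^sub>M ?P) (\<lambda>\<omega>. (X' \<omega>, Y' \<omega>))"
    using indep by (simp add: X'_def Y'_def)
  finally have "distr (distr (M \<Otimes>\<^sub>M ?Q) (V \<Otimes>\<^sub>M ?P) (\<lambda>(\<omega>, \<rho>). (X \<omega>, Y \<rho>))) borel F =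
                distr (distr K (V \<Otimes>\<^sub>M ?P) (\<lambda>\<omega>. (X' \<omega>, Y' \<omega>))) borel F" by simp
  then have "distr (M \<Otimes>\<^sub>M ?Q) borel (\<lambda>(\<omega>, \<rho>). F (X \<omega>, Y \<rho>)) = distr K borel (\<lambda>\<omega>. F (X' \<omega>, Y' \<omega>))"
    by (simp add: distr_distr comp_def case_prod_unfold)
  then show ?thesis
    by (simp add: smoothing_solution_def F_def X_def X'_def Y_def Y'_def I_def compose_def)
qed

end

theory Submission
  imports Defs
begin

text \<open>
  Iterating the fixed point equation \<open>n\<close> times writes \<open>R\<close> as a sum over a weighted \<open>N\<close>-ary tree: a vertex
  \<open>v\<close> carries the product \<open>L(v)\<close> of the coefficients on the path from the root, and the subtree below
  \<open>v\<close> contributes \<open>L(v) R\<^sub>v\<close>, where \<open>R\<^sub>v\<close> is a copy of \<open>R\<close>. Let \<open>W\<^sub>n\<close> be the largest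
  \<open>\<bar>L(v)\<bar>\<close> over the first \<open>n\<close> generations (so \<open>W\<^sub>n \<ge> 1\<close>, because of the root). Three ideas give the theorem.

  Spread. If the path to \<open>v\<close> exceeds \<open>t\<close> for the first time at \<open>v\<close>, then \<open>R\<^sub>v\<close> is still a fresh copy,
  independent of \<open>L(v)\<close> and of the terms outside the subtree, and \<open>L(v) R\<^sub>v\<close> is spread at scale
  \<open>t\<close>, since \<open>R\<close> is not constant; whatever the remaining terms are, the total leaves
  \<open>[-d t, d t]\<close> with conditional probability at least \<open>q\<close>. Hence \<open>\<P>(\<bar>R\<bar> > d t) \<ge> q \<P>(W\<^sub>n > t)\<close> for every
  \<open>n\<close>, and no cancellation between the signed terms can destroy the lower bound. To prove this no tree is
  built: \<open>step_law\<close> maps the joint law of \<open>(R, W\<^sub>n)\<close> on the plane to that of \<open>(R, W\<^sub>n\<^sub>+\<^sub>1)\<close>, and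
  the property \<open>spread_pair\<close> is preserved along this map (\<open>marked_sum_concentration\<close>,
  \<open>spread_pair_step_law\<close>).

  Size of the largest weight. The function \<open>F\<^sub>n(v) = \<P>(v W\<^sub>n > 1)\<close> is \<open>1\<close> for \<open>v > 1\<close>, and for \<open>v \<le> 1\<close> it obeys
  \<open>F\<^sub>n\<^sub>+\<^sub>1(v) = 1 - (1 - \<E> F\<^sub>n(v\<bar>A\<^sub>1\<bar>))\<^sup>N\<close>. The linearised operator
  \<open>f \<mapsto> N \<E> f(v\<bar>A\<^sub>1\<bar>)\<close> multiplies \<open>v\<^sup>s\<close> by \<open>m(s)\<close>. As \<open>m\<close> is strictly convex and
  \<open>m(\<gamma>) = m(\<alpha>) = 1\<close>, there are \<open>b < \<alpha> < \<beta>\<close> with \<open>m(b) < 1 < m(\<beta>)\<close> and \<open>\<beta> \<le> 2\<alpha>\<close>. Then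
  \<open>c (v\<^sup>\<alpha> + v\<^sup>\<beta>) - 2 c m(b)\<^sup>n v\<^sup>b\<close> stays below \<open>F\<^sub>n(v)\<close> for all \<open>n\<close>: the factor \<open>m(\<beta>) > 1\<close> produces a gain
  proportional to \<open>c v\<^sup>\<beta>\<close>, which for small \<open>c\<close> pays for the loss caused by the nonlinearity and by the
  truncation at \<open>1\<close>, a loss of order \<open>c\<^sup>p v\<^sup>\<beta>\<close> with some \<open>p > 1\<close> (\<open>subsolution_step\<close>); the last term makes the
  comparison function nonpositive on \<open>[0, 1]\<close> at \<open>n = 0\<close> and vanishes as \<open>n \<rightarrow> \<infinity>\<close>, because \<open>m(b) < 1\<close>.
  In the limit \<open>\<P>(\<bar>R\<bar> > t)\<close> is at least a multiple of \<open>t\<^sup>-\<^sup>\<alpha>\<close> (\<open>abs_tail_lower_bound\<close>).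

  Signs. One application of the equation passes from \<open>\<bar>R\<bar>\<close> to \<open>R\<close>: with positive probability \<open>A\<^sub>1\<close> is bounded away
  from \<open>0\<close> with a prescribed sign while all terms other than \<open>A\<^sub>1 R\<^sub>1\<close> stay bounded, so a large \<open>\<bar>R\<^sub>1\<bar>\<close> of
  either sign produces a large positive \<open>R\<close> (\<open>one_step_tail\<close>). The left tail is the right tail of
  \<open>-R\<close>, which solves the equation with \<open>-B\<close> in place of \<open>B\<close>.
\<close>

section \<open>Interpolation of absolute moments\<close>

text \<open>
  With \<open>x\<^sup>b\<close> factored out this is \<open>1 + u \<le> e\<^sup>u\<close> at \<open>u = (a - b) ln x\<close> and at \<open>u = (c - b) ln x\<close>, weighted so
  that the linear terms cancel; both inequalities are strict as soon as \<open>ln x \<noteq> 0\<close>.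
\<close>
lemma powr_interpolation:
  fixes x :: real
  assumes "0 \<le> x" "a < b" "b < c"
  shows "(c - a) * x powr b \<le> (c - b) * x powr a + (b - a) * x powr c"
    and "x \<noteq> 0 \<Longrightarrow> x \<noteq> 1 \<Longrightarrow> (c - a) * x powr b < (c - b) * x powr a + (b - a) * x powr c"
proof -
  have strict: "(c - a) * x powr b < (c - b) * x powr a + (b - a) * x powr c" if "x \<noteq> 0" "x \<noteq> 1"
  proof -
    have x: "x > 0" "ln x \<noteq> 0" using that assms by auto
    have e: "1 + u < exp u" if "u \<noteq> 0" for u :: real
      using that exp_minus_greater[of "- u"] by simp
    let ?A = "x powr (a - b)" and ?C = "x powr (c - b)"
    have "1 + (a - b) * ln x < ?A" "1 + (c - b) * ln x < ?C"
      using e[of "(a - b) * ln x"] e[of "(c - b) * ln x"] assms x by (simp_all add: powr_def)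
    then have "(c - b) * (1 + (a - b) * ln x) + (b - a) * (1 + (c - b) * ln x)
        < (c - b) * ?A + (b - a) * ?C"
      using assms by (intro add_strict_mono mult_strict_left_mono) auto
    also have "(c - b) * (1 + (a - b) * ln x) + (b - a) * (1 + (c - b) * ln x) = c - a"
      by algebra
    finally have "(c - a) * x powr b < ((c - b) * ?A + (b - a) * ?C) * x powr b"
      using x by (intro mult_strict_right_mono) auto
    also have "\<dots> = (c - b) * (?A * x powr b) + (b - a) * (?C * x powr b)"
      by algebra
    also have "?A * x powr b = x powr a"
      by (simp flip: powr_add)
    also have "?C * x powr b = x powr c"
      by (simp flip: powr_add)
    finally show ?thesis .
  qed
  show "(c - a) * x powr b < (c - b) * x powr a + (b - a) * x powr c" if "x \<noteq> 0" "x \<noteq> 1"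
    using that by (rule strict)
  show "(c - a) * x powr b \<le> (c - b) * x powr a + (b - a) * x powr c"
    by (cases "x = 0 \<or> x = 1") (use strict in \<open>auto simp: less_imp_le\<close>)
qed

lemma integrable_powr_between:
  fixes X :: "'a \<Rightarrow> real"
  assumes "integrable M (\<lambda>\<omega>. \<bar>X \<omega>\<bar> powr a)" "integrable M (\<lambda>\<omega>. \<bar>X \<omega>\<bar> powr c)"
    and [measurable]: "X \<in> borel_measurable M" and "a \<le> b" "b \<le> c"
  shows "integrable M (\<lambda>\<omega>. \<bar>X \<omega>\<bar> powr b)"
proof (rule Bochner_Integration.integrable_bound)
  show "integrable M (\<lambda>\<omega>. \<bar>X \<omega>\<bar> powr a + \<bar>X \<omega>\<bar> powr c)" using assms by simp
  have "x powr b \<le> x powr a + x powr c" if "x \<ge> 0" for x :: real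
  proof (cases "x \<le> 1")
    case True
    then have "x powr b \<le> x powr a" using that assms by (cases "x = 0") (auto intro: powr_mono')
    then show ?thesis by (simp add: add_increasing2)
  next
    case False
    then have "x powr b \<le> x powr c" using assms by (auto intro: powr_mono)
    then show ?thesis by (simp add: add_increasing)
  qed
  then show "AE \<omega> in M. norm (\<bar>X \<omega>\<bar> powr b) \<le> norm (\<bar>X \<omega>\<bar> powr a + \<bar>X \<omega>\<bar> powr c)"
    by auto
qed measurable

text \<open>
  Used twice: with \<open>\<gamma> < b < \<alpha>\<close> it gives \<open>m(b) < 1\<close>, and with \<open>\<gamma> < \<alpha> < \<beta>\<close> it gives \<open>m(\<beta>) > 1\<close>.
\<close>
lemma moment_strict_interpolation:
  fixes X :: "'a \<Rightarrow> real"
  assumes int: "integrable M (\<lambda>\<omega>. \<bar>X \<omega>\<bar> powr a)" "integrable M (\<lambda>\<omega>. \<bar>X \<omega>\<bar> powr c)"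
    and [measurable]: "X \<in> borel_measurable M" and "a < b" "b < c"
    and nd: "\<not> (AE \<omega> in M. X \<omega> = 0 \<or> \<bar>X \<omega>\<bar> = 1)"
  shows "(c - a) * (\<integral>\<omega>. \<bar>X \<omega>\<bar> powr b \<partial>M)
       < (c - b) * (\<integral>\<omega>. \<bar>X \<omega>\<bar> powr a \<partial>M) + (b - a) * (\<integral>\<omega>. \<bar>X \<omega>\<bar> powr c \<partial>M)"
proof -
  have int_b: "integrable M (\<lambda>\<omega>. \<bar>X \<omega>\<bar> powr b)"
    by (rule integrable_powr_between[OF int]) (use assms in auto)
  let ?d = "\<lambda>\<omega>. (c - b) * \<bar>X \<omega>\<bar> powr a + (b - a) * \<bar>X \<omega>\<bar> powr c - (c - a) * \<bar>X \<omega>\<bar> powr b"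
  have d: "integrable M ?d" using int int_b by auto
  have nn: "0 \<le> ?d \<omega>" for \<omega> using powr_interpolation(1)[of "\<bar>X \<omega>\<bar>" a b c] assms by simp
  have "(\<integral>\<omega>. ?d \<omega> \<partial>M) \<noteq> 0"
  proof
    assume "(\<integral>\<omega>. ?d \<omega> \<partial>M) = 0"
    then have "AE \<omega> in M. ?d \<omega> = 0"
      using integral_nonneg_eq_0_iff_AE[OF d] nn by simp
    then have "AE \<omega> in M. X \<omega> = 0 \<or> \<bar>X \<omega>\<bar> = 1"
      by eventually_elim (use powr_interpolation(2)[OF abs_ge_zero \<open>a < b\<close> \<open>b < c\<close>] in force)
    with nd show False by simp
  qed
  moreover have "(\<integral>\<omega>. ?d \<omega> \<partial>M) \<ge> 0" using nn by (simp add: integral_nonneg)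
  ultimately have "0 < (\<integral>\<omega>. ?d \<omega> \<partial>M)" by simp
  also have "(\<integral>\<omega>. ?d \<omega> \<partial>M) = (c - b) * (\<integral>\<omega>. \<bar>X \<omega>\<bar> powr a \<partial>M) + (b - a) * (\<integral>\<omega>. \<bar>X \<omega>\<bar> powr c \<partial>M)
      - (c - a) * (\<integral>\<omega>. \<bar>X \<omega>\<bar> powr b \<partial>M)"
    using int int_b by simp
  finally show ?thesis by simp
qed

lemma smoothing_m_identically_distributed:
  assumes A: "\<And>i. i \<in> {1..N} \<Longrightarrow> A i \<in> borel_measurable M"
    and ident: "\<forall>i\<in>{1..N}. distr M borel (A i) = distr M borel (A 1)"
  shows "smoothing_m M N A s = of_nat N * (\<integral>\<^sup>+\<omega>. ennreal (\<bar>A 1 \<omega>\<bar> powr s) \<partial>M)"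
proof -
  have *: "(\<integral>\<^sup>+\<omega>. ennreal (\<bar>A i \<omega>\<bar> powr s) \<partial>M) = (\<integral>\<^sup>+\<omega>. ennreal (\<bar>A 1 \<omega>\<bar> powr s) \<partial>M)"
      if i: "i \<in> {1..N}" for i
  proof -
    have 1: "1 \<in> {1..N}" using i by auto
    have "(\<integral>\<^sup>+\<omega>. ennreal (\<bar>A j \<omega>\<bar> powr s) \<partial>M) = (\<integral>\<^sup>+x. ennreal (\<bar>x\<bar> powr s) \<partial>distr M borel (A j))"
        if "j \<in> {1..N}" for j
      using A[OF that] by (subst nn_integral_distr) auto
    from this[OF i] this[OF 1] bspec[OF ident i] show ?thesis by (simp only:)
  qed
  have "smoothing_m M N A s = (\<integral>\<^sup>+\<omega>. (\<Sum>i=1..N. ennreal (\<bar>A i \<omega>\<bar> powr s)) \<partial>M)"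
    unfolding smoothing_m_def by (intro nn_integral_cong sum_ennreal[symmetric]) simp
  also have "\<dots> = (\<Sum>i=1..N. \<integral>\<^sup>+\<omega>. ennreal (\<bar>A i \<omega>\<bar> powr s) \<partial>M)"
    using A by (intro nn_integral_sum) auto
  also have "\<dots> = (\<Sum>i=1..N. \<integral>\<^sup>+\<omega>. ennreal (\<bar>A 1 \<omega>\<bar> powr s) \<partial>M)"
    by (intro sum.cong * refl) auto
  finally show ?thesis by simp
qed

section \<open>A subsolution of the recursion for the tail of the largest weight\<close>

lemma one_minus_power_le:
  fixes y :: real
  assumes "0 \<le> y" "y \<le> 1"
  shows "(1 - y) ^ n \<le> 1 - real n * y + (real n)\<^sup>2 * y\<^sup>2"
proof (induction n)
  case (Suc n)
  have "(1 - y) ^ Suc n \<le> (1 - y) * (1 - real n * y + (real n)\<^sup>2 * y\<^sup>2)"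
    using Suc assms by (simp add: mult_left_mono)
  also have "\<dots> = 1 - real (Suc n) * y + ((real n)\<^sup>2 + real n) * y\<^sup>2 - (real n)\<^sup>2 * y ^ 3"
    by (simp add: algebra_simps power2_eq_square power3_eq_cube)
  also have "\<dots> \<le> 1 - real (Suc n) * y + (real (Suc n))\<^sup>2 * y\<^sup>2"
  proof -
    have "((real n)\<^sup>2 + real n) * y\<^sup>2 \<le> (real (Suc n))\<^sup>2 * y\<^sup>2"
      by (intro mult_right_mono) (auto simp: power2_eq_square algebra_simps)
    moreover have "0 \<le> (real n)\<^sup>2 * y ^ 3" using assms by simp
    ultimately show ?thesis by linarith
  qed
  finally show ?case .
qed simp

text \<open>
  Put \<open>\<beta> = p\<alpha>\<close> and \<open>u = c ((v\<bar>X\<bar>)\<^sup>\<alpha> + (v\<bar>X\<bar>)\<^sup>\<beta>)\<close>. The lower bound for \<open>h\<close> loses at most \<open>u\<^sup>p\<close> through the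
  truncation at \<open>1\<close>, and \<open>1 - (1 - y)\<^sup>N\<close> loses at most \<open>N\<^sup>2 y\<^sup>2\<close> against \<open>N y\<close>. The three exponents
  \<open>\<alpha>, p\<alpha>, p\<^sup>2\<alpha>\<close> form a geometric progression, so that raising the first two to the power \<open>p\<close> gives the last
  two, and both losses are of order \<open>c\<^sup>p v\<^sup>\<beta>\<close>; the hypothesis \<open>small\<close> says that the gain
  \<open>c (N \<E>\<bar>X\<bar>\<^sup>\<beta> - 1) v\<^sup>\<beta>\<close> covers them.
\<close>
lemma subsolution_step:
  fixes M :: "'a measure" and X h :: "'a \<Rightarrow> real" and p \<alpha> b c k v :: real and N :: nat
  defines "I \<equiv> \<lambda>s. \<integral>\<omega>. \<bar>X \<omega>\<bar> powr s \<partial>M"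
  assumes "prob_space M" and [measurable]: "X \<in> borel_measurable M" "h \<in> borel_measurable M"
    and h01: "\<And>\<omega>. 0 \<le> h \<omega>" "\<And>\<omega>. h \<omega> \<le> 1"
    and p: "1 < p" "p \<le> 2" and pos: "0 < \<alpha>" "0 < c" "0 \<le> k" and v: "0 \<le> v" "v \<le> 1"
    and int: "\<And>s. s \<in> {b, \<alpha>, p * \<alpha>, p\<^sup>2 * \<alpha>} \<Longrightarrow> integrable M (\<lambda>\<omega>. \<bar>X \<omega>\<bar> powr s)"
    and lower: "\<And>\<omega>. min 1 (c * ((v * \<bar>X \<omega>\<bar>) powr \<alpha>
        + (v * \<bar>X \<omega>\<bar>) powr (p * \<alpha>)) - k * (v * \<bar>X \<omega>\<bar>) powr b) \<le> h \<omega>"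
    and one: "real N * I \<alpha> = 1"
    and small: "c powr p * (real N * (2 powr p * (I (p * \<alpha>) + I (p\<^sup>2 * \<alpha>)))
                 + (real N)\<^sup>2 * (I \<alpha> + I (p * \<alpha>)) powr p) \<le> c * (real N * I (p * \<alpha>) - 1)"
  shows "c * (v powr \<alpha> + v powr (p * \<alpha>)) - real N * I b * k * v powr b \<le> 1 - (1 - (\<integral>\<omega>. h \<omega> \<partial>M)) ^ N"
proof -
  interpret prob_space M by fact
  let ?\<beta> = "p * \<alpha>" and ?s = "p\<^sup>2 * \<alpha>"
  define u where "u = (\<lambda>\<omega>. c * ((v * \<bar>X \<omega>\<bar>) powr \<alpha> + (v * \<bar>X \<omega>\<bar>) powr ?\<beta>))"
  define r where "r = (\<lambda>\<omega>. (2 * c) powr p * ((v * \<bar>X \<omega>\<bar>) powr ?\<beta>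
      + (v * \<bar>X \<omega>\<bar>) powr ?s) + k * (v * \<bar>X \<omega>\<bar>) powr b)"
  \<comment> \<open>Capping \<open>h\<close> by \<open>u\<close> bounds the mean above by that of \<open>u\<close>, hence the quadratic loss, and keeps the
      lower bound for the mean.\<close>
  define y where "y = (\<integral>\<omega>. min (h \<omega>) (u \<omega>) \<partial>M)"
  have scale: "(\<lambda>\<omega>. (v * \<bar>X \<omega>\<bar>) powr s) = (\<lambda>\<omega>. v powr s * \<bar>X \<omega>\<bar> powr s)" for s
    using v by (simp add: powr_mult)
  have int': "integrable M (\<lambda>\<omega>. (v * \<bar>X \<omega>\<bar>) powr s)"
    and I': "(\<integral>\<omega>. (v * \<bar>X \<omega>\<bar>) powr s \<partial>M) = v powr s * I s" if "s \<in> {b, \<alpha>, ?\<beta>, ?s}" for s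
    using int[OF that] unfolding scale I_def by simp_all
  have I_nn: "0 \<le> I s" for s unfolding I_def by simp
  have u_int: "integrable M u" and r_int: "integrable M r"
    unfolding u_def r_def using int' by auto
  have [measurable]: "u \<in> borel_measurable M" using u_int by simp
  have u_nn: "0 \<le> u \<omega>" for \<omega> using pos by (simp add: u_def)
  have int_u: "(\<integral>\<omega>. u \<omega> \<partial>M) = c * (v powr \<alpha> * I \<alpha> + v powr ?\<beta> * I ?\<beta>)"
    unfolding u_def using int' I' by simp
  have int_r: "(\<integral>\<omega>. r \<omega> \<partial>M) = (2 * c) powr p * (v powr ?\<beta> * I ?\<beta>
      + v powr ?s * I ?s) + k * (v powr b * I b)"
    unfolding r_def using int' I' by simp
  have u_powr: "u \<omega> powr p \<le> (2 * c) powr p * ((v * \<bar>X \<omega>\<bar>) powr ?\<beta> + (v * \<bar>X \<omega>\<bar>) powr ?s)" for \<omega>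
  proof -
    let ?a = "(v * \<bar>X \<omega>\<bar>) powr \<alpha>" and ?b = "(v * \<bar>X \<omega>\<bar>) powr ?\<beta>"
    have "u \<omega> powr p \<le> (2 * c * max ?a ?b) powr p"
      using p pos u_nn[of \<omega>] by (intro powr_mono2) (auto simp: u_def)
    also have "\<dots> = (2 * c) powr p * (max ?a ?b) powr p"
      using pos by (subst powr_mult) auto
    also have "(max ?a ?b) powr p \<le> ?a powr p + ?b powr p"
      by (auto simp: max_def)
    also have "?a powr p + ?b powr p = (v * \<bar>X \<omega>\<bar>) powr ?\<beta> + (v * \<bar>X \<omega>\<bar>) powr ?s"
      by (simp add: powr_powr mult_ac power2_eq_square)
    finally show ?thesis by (simp add: mult_left_mono)
  qed
  \<comment> \<open>Truncation costs nothing when \<open>u \<le> 1\<close>; when \<open>u > 1\<close>, \<open>u - u\<^sup>p\<close> is already nonpositive.\<close>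
  have lower': "u \<omega> - r \<omega> \<le> min (h \<omega>) (u \<omega>)" for \<omega>
  proof -
    define k' where "k' = k * (v * \<bar>X \<omega>\<bar>) powr b"
    have k': "0 \<le> k'" using pos by (simp add: k'_def)
    have *: "u \<omega> - r \<omega> \<le> u \<omega> - u \<omega> powr p - k'"
      using u_powr[of \<omega>] by (simp add: r_def k'_def)
    have **: "min 1 (u \<omega> - k') \<le> h \<omega>" using lower[of \<omega>] by (simp add: u_def k'_def)
    show ?thesis
    proof (cases "u \<omega> \<le> 1")
      case True
      with ** k' have "u \<omega> - k' \<le> h \<omega>" by simp
      moreover have "0 \<le> u \<omega> powr p" by simp
      ultimately show ?thesis unfolding min.bounded_iff using * k' by linarith
    next
      case False
      then have "u \<omega> \<le> u \<omega> powr p" using powr_mono[of 1 p "u \<omega>"] p by simp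
      then show ?thesis unfolding min.bounded_iff using * k' h01(1)[of \<omega>] u_nn[of \<omega>] by linarith
    qed
  qed
  have min_int: "integrable M (\<lambda>\<omega>. min (h \<omega>) (u \<omega>))"
  proof (rule integrable_const_bound[where B = 1])
    have "\<bar>min (h \<omega>) (u \<omega>)\<bar> \<le> 1" for \<omega>
      using h01[of \<omega>] u_nn[of \<omega>] by (auto simp: min_def)
    then show "AE \<omega> in M. norm (min (h \<omega>) (u \<omega>)) \<le> 1" by simp
  qed measurable
  have h_int: "integrable M h"
    by (rule integrable_const_bound[where B = 1]) (use h01 in auto)
  have y_h: "y \<le> (\<integral>\<omega>. h \<omega> \<partial>M)" unfolding y_def by (intro integral_mono min_int h_int) auto
  have h_le: "(\<integral>\<omega>. h \<omega> \<partial>M) \<le> 1" using integral_mono[OF h_int, of "\<lambda>_. 1"] h01 by (simp add: prob_space)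
  have y_nn: "0 \<le> y" unfolding y_def using h01 u_nn by (intro Bochner_Integration.integral_nonneg) auto
  have y_u: "y \<le> (\<integral>\<omega>. u \<omega> \<partial>M)" unfolding y_def by (intro integral_mono min_int u_int) auto
  have y_low: "(\<integral>\<omega>. u \<omega> \<partial>M) - (\<integral>\<omega>. r \<omega> \<partial>M) \<le> y"
  proof -
    have "(\<integral>\<omega>. u \<omega> \<partial>M) - (\<integral>\<omega>. r \<omega> \<partial>M) = (\<integral>\<omega>. u \<omega> - r \<omega> \<partial>M)"
      using u_int r_int by simp
    also have "\<dots> \<le> y"
      unfolding y_def
      by (rule integral_mono[OF Bochner_Integration.integrable_diff[OF u_int r_int] min_int lower'])
    finally show ?thesis .
  qed
  have \<beta>\<alpha>: "v powr ?\<beta> \<le> v powr \<alpha>" and s\<beta>: "v powr ?s \<le> v powr ?\<beta>"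
    using v p pos by (cases "v = 0"; auto intro!: powr_mono' simp: power2_eq_square)+
  have y2: "y\<^sup>2 \<le> c powr p * v powr ?\<beta> * (I \<alpha> + I ?\<beta>) powr p"
  proof -
    \<comment> \<open>This is where \<open>p \<le> 2\<close> enters, that is, \<open>\<beta> \<le> 2\<alpha>\<close>.\<close>
    have "y\<^sup>2 \<le> y powr p"
    proof (cases "y = 0")
      case False
      then have "y powr 2 \<le> y powr p" using y_nn y_h h_le p by (intro powr_mono') auto
      then show ?thesis using False y_nn by simp
    qed simp
    also have "y \<le> c * v powr \<alpha> * (I \<alpha> + I ?\<beta>)"
    proof -
      have "y \<le> c * (v powr \<alpha> * I \<alpha> + v powr ?\<beta> * I ?\<beta>)" using y_u int_u by simp
      also have "\<dots> \<le> c * (v powr \<alpha> * I \<alpha> + v powr \<alpha> * I ?\<beta>)"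
        using \<beta>\<alpha> pos I_nn by (intro mult_left_mono add_left_mono mult_right_mono) auto
      finally show ?thesis by (simp add: algebra_simps)
    qed
    then have "y powr p \<le> (c * v powr \<alpha> * (I \<alpha> + I ?\<beta>)) powr p"
      using y_nn p by (intro powr_mono2) auto
    also have "\<dots> = c powr p * v powr ?\<beta> * (I \<alpha> + I ?\<beta>) powr p"
      using pos I_nn by (simp add: powr_mult powr_powr mult_ac)
    finally show ?thesis .
  qed
  have "c * (v powr \<alpha> + v powr ?\<beta>) - real N * I b * k * v powr b \<le> real N * y - (real N)\<^sup>2 * y\<^sup>2"
  proof -
    have r_le: "(\<integral>\<omega>. r \<omega> \<partial>M) \<le> c powr p * (2 powr p * (I ?\<beta> + I ?s)) * v powr ?\<beta> + k * (v powr b * I b)"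
    proof -
      have "(2 * c) powr p * (v powr ?\<beta> * I ?\<beta> + v powr ?s * I ?s)
          \<le> (2 * c) powr p * (v powr ?\<beta> * I ?\<beta> + v powr ?\<beta> * I ?s)"
        using s\<beta> I_nn by (intro mult_left_mono add_left_mono mult_right_mono) auto
      also have "\<dots> = c powr p * (2 powr p * (I ?\<beta> + I ?s)) * v powr ?\<beta>"
        using pos by (simp add: powr_mult algebra_simps)
      finally show ?thesis unfolding int_r by simp
    qed
    have "real N * (\<integral>\<omega>. u \<omega> \<partial>M) - real N * (c powr p * (2 powr p * (I ?\<beta>
        + I ?s)) * v powr ?\<beta> + k * (v powr b * I b)) \<le> real N * y"
      unfolding right_diff_distrib[symmetric] using y_low r_le by (intro mult_left_mono) auto
    moreover have "real N * (\<integral>\<omega>. u \<omega> \<partial>M) = c * v powr \<alpha> + c * (real N * I ?\<beta>) * v powr ?\<beta>"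
    proof -
      have "real N * (\<integral>\<omega>. u \<omega> \<partial>M) = c * v powr \<alpha> * (real N * I \<alpha>) + c * (real N * I ?\<beta>) * v powr ?\<beta>"
        unfolding int_u by algebra
      then show ?thesis using one by simp
    qed
    moreover have "(real N)\<^sup>2 * y\<^sup>2 \<le> (real N)\<^sup>2 * (c powr p * v powr ?\<beta> * (I \<alpha> + I ?\<beta>) powr p)"
      using y2 by (intro mult_left_mono) auto
    moreover have "c powr p * (real N * (2 powr p * (I ?\<beta> + I ?s))
        + (real N)\<^sup>2 * (I \<alpha> + I ?\<beta>) powr p) * v powr ?\<beta> \<le> c * (real N * I ?\<beta> - 1) * v powr ?\<beta>"
      using small by (intro mult_right_mono) auto
    ultimately show ?thesis by (simp add: algebra_simps)
  qed
  also have "\<dots> \<le> 1 - (1 - y) ^ N"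
    using one_minus_power_le[of y N] y_nn y_h h_le by simp
  also have "\<dots> \<le> 1 - (1 - (\<integral>\<omega>. h \<omega> \<partial>M)) ^ N"
    using y_h h_le by (simp add: power_mono)
  finally show ?thesis .
qed

section \<open>Spread of sums and of nontrivial laws\<close>

text \<open>
  If on its mark \<open>D i\<close> each summand hits any interval of length \<open>2 s\<close> with proportion at most \<open>p\<close>, then so
  does the whole sum on the event that some mark occurs. Adding the coordinate \<open>i\<close>, one splits
  according to whether \<open>i\<close> is marked: if it is, the spread of \<open>f i\<close> is used with all other coordinates frozen;
  if it is not, coordinate \<open>i\<close> is frozen and the induction hypothesis is applied to the others.
\<close>
lemma marked_sum_concentration:
  fixes f :: "'i \<Rightarrow> 'z \<Rightarrow> real" and D :: "'i \<Rightarrow> 'z set" and p :: ennreal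
  assumes K: "prob_space K" and "finite J"
    and "\<And>i. i \<in> J \<Longrightarrow> f i \<in> borel_measurable K"
    and "\<And>i. i \<in> J \<Longrightarrow> D i \<in> sets K"
    and "\<And>i y. i \<in> J \<Longrightarrow> emeasure K {z \<in> D i. \<bar>f i z - y\<bar> \<le> s} \<le> p * emeasure K (D i)"
  shows "emeasure (PiM J (\<lambda>_. K)) {\<rho> \<in> space (PiM J (\<lambda>_. K)).
             (\<exists>i\<in>J. \<rho> i \<in> D i) \<and> \<bar>(\<Sum>i\<in>J. f i (\<rho> i)) - y\<bar> \<le> s}
         \<le> p * emeasure (PiM J (\<lambda>_. K)) {\<rho> \<in> space (PiM J (\<lambda>_. K)). \<exists>i\<in>J. \<rho> i \<in> D i}"
  using assms(2-)
proof (induction J arbitrary: y rule: finite_induct)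
  case empty
  then show ?case by simp
next
  case (insert i J)
  interpret K: prob_space K by fact
  interpret P: product_prob_space "\<lambda>_. K" by standard
  let ?Q = "PiM J (\<lambda>_. K)" and ?Q' = "PiM (insert i J) (\<lambda>_. K)"
  interpret Q: prob_space ?Q by (intro prob_space_PiM K)
  have f[measurable]: "f j \<in> borel_measurable K" if "j \<in> insert i J" for j using insert that by auto
  have D[measurable]: "D j \<in> sets K" if "j \<in> insert i J" for j using insert that by auto
  have mS'[measurable]: "(\<lambda>x. \<Sum>j\<in>insert i J. f j (x j)) \<in> borel_measurable ?Q'" by measurable
  define S where "S = (\<lambda>x. \<Sum>j\<in>J. f j (x j))"
  have S[measurable]: "S \<in> borel_measurable ?Q" unfolding S_def by measurable
  define E where "E = {x \<in> space ?Q. \<exists>j\<in>J. x j \<in> D j}"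
  have E[measurable]: "E \<in> sets ?Q" unfolding E_def using insert.hyps(1) by measurable
  define c where "c = emeasure K (D i) + emeasure K (space K - D i) * emeasure ?Q E"
  have fD: "f i \<in> borel_measurable K" "D i \<in> sets K" by simp_all
  note [measurable] = fD
  have upd: "x(i := z) \<in> space ?Q'" if "x \<in> space ?Q" "z \<in> space K" for x z
    using that insert.hyps by (auto simp: space_PiM PiE_def extensional_def Pi_def)
  have eq0: "(\<exists>j\<in>insert i J. (x(i := z)) j \<in> D j) \<longleftrightarrow> z \<in> D i \<or> (\<exists>j\<in>J. x j \<in> D j)" for x z
    using insert.hyps(2) by auto
  have eq1: "(\<Sum>j\<in>insert i J. f j ((x(i := z)) j)) = f i z + S x" for x z
    using insert.hyps unfolding S_def by (subst sum.insert) (auto intro!: sum.cong)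
  have "emeasure ?Q' {\<rho> \<in> space ?Q'. (\<exists>j\<in>insert i J. \<rho> j \<in> D j)}
      = (\<integral>\<^sup>+\<rho>. indicator {\<rho> \<in> space ?Q'. (\<exists>j\<in>insert i J. \<rho> j \<in> D j)} \<rho> \<partial>?Q')"
    using insert.hyps(1) by (subst nn_integral_indicator) (measurable, auto intro: countable_finite)
  also have "\<dots> = (\<integral>\<^sup>+z. (\<integral>\<^sup>+x. indicator {\<rho> \<in> space ?Q'.
      (\<exists>j\<in>insert i J. \<rho> j \<in> D j)} (x(i := z)) \<partial>?Q) \<partial>K)"
    using insert.hyps by (intro P.product_nn_integral_insert_rev) (auto, measurable)
  also have "\<dots> = (\<integral>\<^sup>+z. (\<integral>\<^sup>+x. indicator (D i) z + indicator (space K - D i) z * indicator E x \<partial>?Q) \<partial>K)"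
    by (intro nn_integral_cong) (use eq0 upd in \<open>auto simp: indicator_def E_def\<close>)
  also have "\<dots> = (\<integral>\<^sup>+z. indicator (D i) z + indicator (space K - D i) z * emeasure ?Q E \<partial>K)"
    by (simp add: nn_integral_add nn_integral_cmult Q.emeasure_space_1)
  also have "\<dots> = c"
    by (simp add: nn_integral_add nn_integral_multc c_def)
  finally have R: "emeasure ?Q' {\<rho> \<in> space ?Q'. (\<exists>j\<in>insert i J. \<rho> j \<in> D j)} = c" .
  let ?F = "{\<rho> \<in> space ?Q'. (\<exists>j\<in>insert i J. \<rho> j \<in> D j) \<and> \<bar>(\<Sum>j\<in>insert i J. f j (\<rho> j)) - y\<bar> \<le> s}"
  \<comment> \<open>\<open>G1\<close> is the part of the event with coordinate \<open>i\<close> marked, \<open>G2\<close> the part with it unmarked.\<close>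
  define G1 where "G1 = (\<lambda>x z. indicator {z \<in> D i. \<bar>f i z - (y - S x)\<bar> \<le> s} z :: ennreal)"
  define G2 where "G2 = (\<lambda>x z. indicator (space K - D i) z *
     indicator {x \<in> space ?Q. (\<exists>j\<in>J. x j \<in> D j) \<and> \<bar>S x - (y - f i z)\<bar> \<le> s} x :: ennreal)"
  have DK: "D i \<subseteq> space K" using fD(2) by (rule sets.sets_into_space)
  have G1m[measurable]: "(\<lambda>(x, z). G1 x z) \<in> borel_measurable (?Q \<Otimes>\<^sub>M K)"
  proof -
    have "(\<lambda>(x, z). indicator (D i) z * indicator {q \<in> space (?Q \<Otimes>\<^sub>M K). \<bar>f i (snd q) -
        (y - S (fst q))\<bar> \<le> s} (x, z) :: ennreal) \<in> borel_measurable (?Q \<Otimes>\<^sub>M K)"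
      by measurable
    also have "?this \<longleftrightarrow> ?thesis"
      using DK by (intro measurable_cong) (auto simp: G1_def indicator_def space_pair_measure)
    finally show ?thesis .
  qed
  have G2m[measurable]: "(\<lambda>(x, z). G2 x z) \<in> borel_measurable (?Q \<Otimes>\<^sub>M K)"
  proof -
    have "(\<lambda>(x, z). indicator (space K - D i) z * (indicator E x * indicator {q \<in> space
        (?Q \<Otimes>\<^sub>M K). \<bar>S (fst q) - (y - f i (snd q))\<bar>
            \<le> s} (x, z)) :: ennreal) \<in> borel_measurable (?Q \<Otimes>\<^sub>M K)"
      by measurable
    also have "?this \<longleftrightarrow> ?thesis"
      by (intro measurable_cong) (auto simp: G2_def E_def indicator_def space_pair_measure)
    finally show ?thesis .
  qed
  have "emeasure ?Q' ?F = (\<integral>\<^sup>+\<rho>. indicator ?F \<rho> \<partial>?Q')"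
    using insert.hyps(1) by (subst nn_integral_indicator) (measurable, auto intro: countable_finite)
  also have "\<dots> = (\<integral>\<^sup>+x. (\<integral>\<^sup>+z. indicator ?F (x(i := z)) \<partial>K) \<partial>?Q)"
    using insert.hyps by (intro P.product_nn_integral_insert) (auto, measurable)
  also have "\<dots> = (\<integral>\<^sup>+x. (\<integral>\<^sup>+z. G1 x z + G2 x z \<partial>K) \<partial>?Q)"
  proof (intro nn_integral_cong)
    fix x z assume "x \<in> space ?Q" "z \<in> space K"
    then show "indicator ?F (x(i := z)) = G1 x z + G2 x z"
      unfolding G1_def G2_def indicator_def mem_Collect_eq eq0 eq1 using upd
      by (auto simp: algebra_simps)
  qed
  also have "\<dots> = (\<integral>\<^sup>+x. (\<integral>\<^sup>+z. G1 x z \<partial>K) \<partial>?Q) + (\<integral>\<^sup>+x. (\<integral>\<^sup>+z. G2 x z \<partial>K) \<partial>?Q)"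
  proof -
    have "(\<integral>\<^sup>+x. (\<integral>\<^sup>+z. G1 x z + G2 x z \<partial>K) \<partial>?Q) = (\<integral>\<^sup>+x. (\<integral>\<^sup>+z. G1 x z \<partial>K) + (\<integral>\<^sup>+z. G2 x z \<partial>K) \<partial>?Q)"
      by (intro nn_integral_cong nn_integral_add) measurable
    also have "\<dots> = (\<integral>\<^sup>+x. (\<integral>\<^sup>+z. G1 x z \<partial>K) \<partial>?Q) + (\<integral>\<^sup>+x. (\<integral>\<^sup>+z. G2 x z \<partial>K) \<partial>?Q)"
      by (intro nn_integral_add) measurable
    finally show ?thesis .
  qed
  also have "(\<integral>\<^sup>+x. (\<integral>\<^sup>+z. G2 x z \<partial>K) \<partial>?Q) = (\<integral>\<^sup>+z. (\<integral>\<^sup>+x. G2 x z \<partial>?Q) \<partial>K)"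
  proof -
    interpret pair_sigma_finite ?Q K ..
    show ?thesis by (rule Fubini'[symmetric]) measurable
  qed
  also have "(\<integral>\<^sup>+x. (\<integral>\<^sup>+z. G1 x z \<partial>K) \<partial>?Q) \<le> (\<integral>\<^sup>+x. p * emeasure K (D i) \<partial>?Q)"
  proof (intro nn_integral_mono)
    fix x
    have "(\<integral>\<^sup>+z. G1 x z \<partial>K) = emeasure K {z \<in> D i. \<bar>f i z - (y - S x)\<bar> \<le> s}"
    proof -
      have "{z \<in> D i. \<bar>f i z - (y - S x)\<bar> \<le> s} = D i \<inter> {z \<in> space K. \<bar>f i z - (y - S x)\<bar> \<le> s}"
        using DK by auto
      also have "\<dots> \<in> sets K" by measurable
      finally show ?thesis by (simp add: G1_def)
    qed
    then show "(\<integral>\<^sup>+z. G1 x z \<partial>K) \<le> p * emeasure K (D i)"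
      using insert.prems(3)[of i] by simp
  qed
  also have "(\<integral>\<^sup>+z. (\<integral>\<^sup>+x. G2 x z \<partial>?Q) \<partial>K)
      \<le> (\<integral>\<^sup>+z. indicator (space K - D i) z * (p * emeasure ?Q E) \<partial>K)"
  proof (intro nn_integral_mono)
    fix z
    let ?H = "{x \<in> space ?Q. (\<exists>j\<in>J. x j \<in> D j) \<and> \<bar>S x - (y - f i z)\<bar> \<le> s}"
    have "?H = E \<inter> {x \<in> space ?Q. \<bar>S x - (y - f i z)\<bar> \<le> s}" by (auto simp: E_def)
    also have "\<dots> \<in> sets ?Q" by measurable
    finally have "?H \<in> sets ?Q" .
    then have "(\<integral>\<^sup>+x. G2 x z \<partial>?Q) = indicator (space K - D i) z * emeasure ?Q ?H"
      unfolding G2_def by (subst nn_integral_cmult) auto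
    also have "\<dots> \<le> indicator (space K - D i) z * (p * emeasure ?Q E)"
      unfolding E_def S_def by (intro mult_left_mono insert.IH) (use insert.prems in auto)
    finally show "(\<integral>\<^sup>+x. G2 x z \<partial>?Q) \<le> indicator (space K - D i) z * (p * emeasure ?Q E)" .
  qed
  also have "(\<integral>\<^sup>+x. p * emeasure K (D i) \<partial>?Q) + (\<integral>\<^sup>+z. indicator
      (space K - D i) z * (p * emeasure ?Q E) \<partial>K) = p * c"
    by (subst nn_integral_multc) (auto simp: Q.emeasure_space_1 c_def algebra_simps)
  finally show ?case unfolding R by (simp add: add_mono)
qed

text \<open>
  A nonconstant law charges two half-lines at a positive distance \<open>e\<close>, and an interval of length
  \<open>2 e / 3\<close> misses at least one of them.
\<close>
lemma (in prob_space) nontrivial_spread: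
  assumes [measurable]: "X \<in> borel_measurable M" and nt: "nontrivial_rv M X"
  obtains q d :: real where "0 < q" "q \<le> 1" "0 < d"
    "\<And>y. emeasure (distr M borel X) {x. \<bar>x - y\<bar> \<le> d} \<le> ennreal (1 - q)"
proof -
  \<comment> \<open>If every cut were trivial, almost all values of \<open>X\<close> would define the same cut of the rationals.\<close>
  have "\<exists>x. \<not> (AE \<omega> in M. X \<omega> \<le> x) \<and> \<not> (AE \<omega> in M. x < X \<omega>)"
  proof (rule ccontr)
    assume *: "\<not> ?thesis"
    have "AE \<omega> in M. \<forall>r::rat. (X \<omega> \<le> of_rat r) = (AE \<omega>' in M. X \<omega>' \<le> of_rat r)"
      unfolding AE_all_countable
    proof
      fix r :: rat
      show "AE \<omega> in M. (X \<omega> \<le> of_rat r) = (AE \<omega>' in M. X \<omega>' \<le> of_rat r)"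
      proof (cases "AE \<omega>' in M. X \<omega>' \<le> of_rat r")
        case False
        with * have "AE \<omega> in M. of_rat r < X \<omega>" by blast
        then show ?thesis by eventually_elim (use False in auto)
      qed simp
    qed
    then have AE: "AE \<omega> in M. \<forall>r::rat. (X \<omega> \<le> of_rat r) = (AE \<omega>' in M. X \<omega>' \<le> of_rat r)" .
    obtain \<omega>0 where \<omega>0: "\<forall>r::rat. (X \<omega>0 \<le> of_rat r) = (AE \<omega>' in M. X \<omega>' \<le> of_rat r)"
      using eventually_happens[OF AE] ae_filter_bot by blast
    have "AE \<omega> in M. X \<omega> = X \<omega>0"
      using AE
    proof eventually_elim
      case (elim \<omega>)
      with \<omega>0 have same: "X \<omega> \<le> of_rat r \<longleftrightarrow> X \<omega>0 \<le> of_rat r" for r by blast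
      show ?case
      proof (rule ccontr)
        assume "X \<omega> \<noteq> X \<omega>0"
        then consider "X \<omega> < X \<omega>0" | "X \<omega>0 < X \<omega>" by linarith
        then show False
          by cases (use same in \<open>metis of_rat_dense less_le_not_le not_less order.strict_trans1\<close>)+
      qed
    qed
    with nt show False unfolding nontrivial_rv_def by blast
  qed
  then obtain x where x: "\<not> (AE \<omega> in M. X \<omega> \<le> x)" "\<not> (AE \<omega> in M. x < X \<omega>)" by blast
  have "\<exists>n::nat. \<not> (AE \<omega> in M. X \<omega> < x + 1 / real (Suc n))"
  proof (rule ccontr)
    assume "\<not> ?thesis"
    then have "AE \<omega> in M. \<forall>n::nat. X \<omega> < x + 1 / real (Suc n)"
      unfolding AE_all_countable by blast
    then have "AE \<omega> in M. X \<omega> \<le> x"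
    proof eventually_elim
      case (elim \<omega>)
      show ?case
      proof (rule ccontr)
        assume "\<not> X \<omega> \<le> x"
        then obtain n where "1 / real (Suc n) < X \<omega> - x" using nat_approx_posE[of "X \<omega> - x"] by auto
        with elim show False by (smt (verit))
      qed
    qed
    with x show False by simp
  qed
  then obtain n :: nat where n: "\<not> (AE \<omega> in M. X \<omega> < x + 1 / real (Suc n))" by blast
  define e where "e = 1 / real (Suc n)"
  have e: "0 < e" by (simp add: e_def)
  define lo where "lo = prob {\<omega> \<in> space M. X \<omega> \<le> x}"
  define hi where "hi = prob {\<omega> \<in> space M. x + e \<le> X \<omega>}"
  have pos: "0 < lo" "0 < hi"
  proof -
    have "lo \<noteq> 0"
    proof
      assume "lo = 0"
      then have "AE \<omega> in M. \<not> X \<omega> \<le> x" unfolding lo_def by (subst (asm) prob_eq_0) auto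
      with x(2) show False by (simp add: not_le)
    qed
    then show "0 < lo" by (simp add: lo_def zero_less_measure_iff)
    have "hi \<noteq> 0"
    proof
      assume "hi = 0"
      then have "AE \<omega> in M. \<not> x + e \<le> X \<omega>" unfolding hi_def by (subst (asm) prob_eq_0) auto
      with n show False by (simp add: not_le e_def)
    qed
    then show "0 < hi" by (simp add: hi_def zero_less_measure_iff)
  qed
  show ?thesis
  proof (rule that)
    show "0 < min lo hi" "min lo hi \<le> 1" "0 < e / 3" using pos e by
        (simp_all add: lo_def min.coboundedI1)
    fix y
    let ?S = "{\<omega> \<in> space M. \<bar>X \<omega> - y\<bar> \<le> e / 3}"
    have disj: "prob ?S \<le> 1 - prob T" if T: "T \<in> events" "?S \<inter> T = {}" for T
    proof -
      have "prob (?S \<union> T) = prob ?S + prob T" by (rule finite_measure_Union) (use T in auto)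
      then show ?thesis using prob_le_1[of "?S \<union> T"] by simp
    qed
    have "prob ?S \<le> 1 - min lo hi"
    proof (cases "x + e / 2 < y")
      case True
      have "prob ?S \<le> 1 - lo" unfolding lo_def using True e by (intro disj) auto
      then show ?thesis by linarith
    next
      case False
      have "prob ?S \<le> 1 - hi" unfolding hi_def using False e by (intro disj) auto
      then show ?thesis by linarith
    qed
    moreover have "emeasure (distr M borel X) {x. \<bar>x - y\<bar> \<le> e / 3} = ennreal (prob ?S)"
      by (subst emeasure_distr) (auto simp: emeasure_eq_measure intro!: arg_cong[where f = prob])
    ultimately show "emeasure (distr M borel X) {x. \<bar>x - y\<bar> \<le> e / 3} \<le> ennreal (1 - min lo hi)"
      by (simp add: ennreal_leI)
  qed
qed

section \<open>One generation of the branching recursion\<close>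

lemma fst_snd_borel_measurable [measurable]:
  "fst \<in> borel_measurable (borel :: (real \<times> real) measure)"
  "snd \<in> borel_measurable (borel :: (real \<times> real) measure)"
  by (simp_all add: borel_prod[symmetric])

lemma fst_snd_measurable:
  fixes K :: "(real \<times> real) measure"
  assumes "sets K = sets borel"
  shows "fst \<in> borel_measurable K" "snd \<in> borel_measurable K"
  using fst_snd_borel_measurable measurable_cong_sets[OF assms refl] by blast+

text \<open>
  Nondegeneracy of \<open>R\<close> conditionally on \<open>W > t\<close>, for the law of \<open>(R, W)\<close>; the product form avoids dividing by
  the probability of an event that may be null. All \<open>t\<close> are needed at once, since a coefficient
  \<open>A\<^sub>i\<close> turns the scale \<open>t\<close> into \<open>t / \<bar>A\<^sub>i\<bar>\<close>, and all centres \<open>y\<close>, since the other summands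
  shift the interval.
\<close>
definition spread_pair :: "real \<Rightarrow> real \<Rightarrow> (real \<times> real) measure \<Rightarrow> bool" where
  "spread_pair q d K \<longleftrightarrow> (\<forall>t>0. \<forall>y.
     emeasure K {z \<in> space K. \<bar>fst z - y\<bar> \<le> d * t \<and> t < snd z}
         \<le> ennreal (1 - q) * emeasure K {z \<in> space K. t < snd z})"

locale smoothing_coefficients = prob_space M
  for M :: "'a measure" +
  fixes N :: nat and A :: "nat \<Rightarrow> 'a \<Rightarrow> real" and B :: "'a \<Rightarrow> real"
  assumes N_pos: "N > 0"
    and A_measurable: "\<And>i. i \<in> {1..N} \<Longrightarrow> A i \<in> borel_measurable M"
    and B_measurable: "B \<in> borel_measurable M"
begin

declare A_measurable [measurable] B_measurable [measurable]

definition step_map :: "'a \<times> (nat \<Rightarrow> real \<times> real) \<Rightarrow> real \<times> real" where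
  "step_map = (\<lambda>(\<omega>, \<rho>). ((\<Sum>i=1..N. A i \<omega> * fst (\<rho> i)) + B \<omega>,
                            max 1 (Max ((\<lambda>i. \<bar>A i \<omega>\<bar> * snd (\<rho> i)) ` {1..N}))))"

text \<open>
  If the second coordinate is the largest absolute weight in the first \<open>n\<close> generations, then after the map it is
  the one for \<open>n + 1\<close> generations, the entry \<open>1\<close> in the maximum being the weight of the root.
\<close>
definition step_law :: "(real \<times> real) measure \<Rightarrow> (real \<times> real) measure" where
  "step_law K = distr (M \<Otimes>\<^sub>M (\<Pi>\<^sub>M i\<in>{1..N}. K)) borel step_map"

lemma less_snd_step_map:
  "t < snd (step_map (\<omega>, \<rho>)) \<longleftrightarrow> t < 1 \<or> (\<exists>i\<in>{1..N}. t < \<bar>A i \<omega>\<bar> * snd (\<rho> i))"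
  using N_pos by (auto simp: step_map_def less_max_iff_disj Max_gr_iff)

lemma step_map_measurable:
  assumes "sets K = sets borel"
  shows "step_map \<in> borel_measurable (M \<Otimes>\<^sub>M (\<Pi>\<^sub>M i\<in>{1..N}. K))"
proof -
  note [measurable] = fst_snd_measurable[OF assms]
  show ?thesis unfolding step_map_def by measurable
qed

lemma prob_space_step_law:
  assumes "prob_space K" "sets K = sets borel"
  shows "prob_space (step_law K)"
proof -
  interpret Q: prob_space "\<Pi>\<^sub>M i\<in>{1..N}. K" by (intro prob_space_PiM assms)
  interpret P: pair_prob_space M "\<Pi>\<^sub>M i\<in>{1..N}. K" ..
  show ?thesis unfolding step_law_def using step_map_measurable[OF assms(2)] by (rule P.prob_space_distr)
qed

lemma emeasure_step_law:
  assumes "prob_space K" "sets K = sets borel" "Measurable.pred borel P"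
  shows "emeasure (step_law K) {z. P z} =
    (\<integral>\<^sup>+\<omega>. emeasure (\<Pi>\<^sub>M i\<in>{1..N}. K) {\<rho> \<in> space (\<Pi>\<^sub>M i\<in>{1..N}. K). P (step_map (\<omega>, \<rho>))} \<partial>M)"
proof -
  let ?Q = "\<Pi>\<^sub>M i\<in>{1..N}. K"
  interpret Q: prob_space ?Q by (intro prob_space_PiM assms)
  note [measurable] = step_map_measurable[OF assms(2)] assms(3)
  have "emeasure (step_law K) {z. P z} = emeasure (M \<Otimes>\<^sub>M ?Q) {p \<in> space (M \<Otimes>\<^sub>M ?Q). P (step_map p)}"
    unfolding step_law_def
    by (subst emeasure_distr[OF step_map_measurable[OF assms(2)]])
       (measurable, auto intro!: arg_cong2[where f = emeasure])
  also have "\<dots> = (\<integral>\<^sup>+\<omega>. emeasure ?Q (Pair \<omega> -` {p \<in> space (M \<Otimes>\<^sub>M ?Q). P (step_map p)}) \<partial>M)"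
    by (rule Q.emeasure_pair_measure_alt) measurable
  also have "\<dots> = (\<integral>\<^sup>+\<omega>. emeasure ?Q {\<rho> \<in> space ?Q. P (step_map (\<omega>, \<rho>))} \<partial>M)"
    by (intro nn_integral_cong arg_cong2[where f = emeasure]) (auto simp: space_pair_measure)
  finally show ?thesis .
qed

text \<open>
  For \<open>t \<ge> 1\<close> the event \<open>W > t\<close> after the step means that some \<open>\<bar>A\<^sub>i\<bar> W\<^sub>i > t\<close>, and given the
  coefficients the summand \<open>A\<^sub>i R\<^sub>i\<close> is spread at scale \<open>t\<close> on this event, by the assumption at level
  \<open>t / \<bar>A\<^sub>i\<bar>\<close>. For \<open>t < 1\<close> the event is certain, and only the spread of the law of \<open>R\<close> itself matters.
\<close>
lemma spread_pair_step_law: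
  assumes K: "prob_space K" "sets K = sets borel" and spread: "spread_pair q d K"
    and d: "0 \<le> d" and q: "q \<le> 1" and base: "\<And>y. emeasure (step_law K) {z. \<bar>fst z - y\<bar>
        \<le> d} \<le> ennreal (1 - q)"
  shows "spread_pair q d (step_law K)"
  unfolding spread_pair_def
proof (intro allI impI)
  fix t y :: real assume "0 < t"
  let ?Q = "\<Pi>\<^sub>M i\<in>{1..N}. K"
  interpret K: prob_space K by fact
  interpret S: prob_space "step_law K" by (rule prob_space_step_law[OF K])
  have [simp]: "space (step_law K) = UNIV" "sets (step_law K) = sets borel"
    by (simp_all add: step_law_def)
  have spK: "space K = UNIV" using sets_eq_imp_space_eq[OF K(2)] by simp
  note [measurable] = fst_snd_measurable[OF K(2)]
  show "emeasure (step_law K) {z \<in> space (step_law K). \<bar>fst z - y\<bar> \<le> d * t \<and> t < snd z}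
     \<le> ennreal (1 - q) * emeasure (step_law K) {z \<in> space (step_law K). t < snd z}"
  proof (cases "t < 1")
    case True
    have "emeasure (step_law K) {z. t < snd z} = 1"
      using True by (subst emeasure_step_law[OF K]) (auto simp: less_snd_step_map
          prob_space.emeasure_space_1[OF prob_space_PiM[OF K(1)]] emeasure_space_1)
    moreover have "emeasure (step_law K) {z. \<bar>fst z - y\<bar> \<le> d * t \<and> t < snd z}
        \<le> emeasure (step_law K) {z. \<bar>fst z - y\<bar> \<le> d}"
    proof (rule emeasure_mono)
      have "d * t \<le> d" using True d by (simp add: mult_left_le)
      then show "{z. \<bar>fst z - y\<bar> \<le> d * t \<and> t < snd z} \<subseteq> {z. \<bar>fst z - y\<bar> \<le> d}" by auto
      show "{z. \<bar>fst z - y\<bar> \<le> d} \<in> sets (step_law K)" by simp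
    qed
    ultimately show ?thesis using base[of y] by simp
  next
    case False
    have *: "emeasure ?Q {\<rho> \<in> space ?Q. \<bar>fst (step_map (\<omega>, \<rho>)) - y\<bar> \<le> d * t \<and> t < snd (step_map (\<omega>, \<rho>))}
        \<le> ennreal (1 - q) * emeasure ?Q {\<rho> \<in> space ?Q. t < snd (step_map (\<omega>, \<rho>))}" for \<omega>
    proof -
      let ?D = "\<lambda>i. {z. t < \<bar>A i \<omega>\<bar> * snd z}"
      have "emeasure ?Q {\<rho> \<in> space ?Q. (\<exists>i\<in>{1..N}. \<rho> i \<in> ?D i)
          \<and> \<bar>(\<Sum>i\<in>{1..N}. A i \<omega> * fst (\<rho> i)) - (y - B \<omega>)\<bar> \<le> d * t}
         \<le> ennreal (1 - q) * emeasure ?Q {\<rho> \<in> space ?Q. \<exists>i\<in>{1..N}. \<rho> i \<in> ?D i}"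
      proof (rule marked_sum_concentration[OF K(1), where f = "\<lambda>i z. A i \<omega> * fst z"])
        show "?D i \<in> sets K" for i
        proof -
          have "{z \<in> space K. t < \<bar>A i \<omega>\<bar> * snd z} \<in> sets K" by measurable
          then show ?thesis by (simp add: spK)
        qed
        show "emeasure K {z \<in> ?D i. \<bar>A i \<omega> * fst z - x\<bar> \<le> d * t}
            \<le> ennreal (1 - q) * emeasure K (?D i)" for i x
        proof (cases "A i \<omega> = 0")
          case True
          then show ?thesis using \<open>0 < t\<close> by simp
        next
          case False
          let ?a = "A i \<omega>"
          have "{z \<in> ?D i. \<bar>?a * fst z - x\<bar> \<le> d * t} = {z \<in> space K. \<bar>fst z - x / ?a\<bar>
              \<le> d * (t / \<bar>?a\<bar>) \<and> t / \<bar>?a\<bar> < snd z}"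
          proof -
            have "\<bar>?a * r - x\<bar> = \<bar>?a\<bar> * \<bar>r - x / ?a\<bar>" for r
              using False by (simp add: right_diff_distrib flip: abs_mult)
            then show ?thesis using False by (auto simp: spK field_simps)
          qed
          moreover have "?D i = {z \<in> space K. t / \<bar>?a\<bar> < snd z}"
            using False by (auto simp: spK field_simps)
          ultimately show ?thesis
            using spread[unfolded spread_pair_def, rule_format,
                of "t / \<bar>?a\<bar>" "x / ?a"] False \<open>0 < t\<close> by simp
        qed
      qed auto
      then show ?thesis using False by (simp add: less_snd_step_map)
          (simp add: step_map_def conj_commute algebra_simps)
    qed
    have "emeasure (step_law K) {z. \<bar>fst z - y\<bar> \<le> d * t \<and> t < snd z}
       = (\<integral>\<^sup>+\<omega>. emeasure ?Q {\<rho> \<in> space ?Q. \<bar>fst (step_map (\<omega>, \<rho>)) - y\<bar>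
           \<le> d * t \<and> t < snd (step_map (\<omega>, \<rho>))} \<partial>M)"
      by (rule emeasure_step_law[OF K]) measurable
    also have "\<dots> \<le> (\<integral>\<^sup>+\<omega>. ennreal (1 - q) * emeasure ?Q {\<rho> \<in> space ?Q. t < snd (step_map (\<omega>, \<rho>))} \<partial>M)"
      by (intro nn_integral_mono *)
    also have "\<dots> = ennreal (1 - q) * (\<integral>\<^sup>+\<omega>. emeasure ?Q {\<rho> \<in> space ?Q. t < snd (step_map (\<omega>, \<rho>))} \<partial>M)"
    proof (rule nn_integral_cmult)
      interpret Q: prob_space ?Q by (intro prob_space_PiM K)
      note [measurable] = step_map_measurable[OF K(2)]
      show "(\<lambda>\<omega>. emeasure ?Q {\<rho> \<in> space ?Q. t < snd (step_map (\<omega>, \<rho>))}) \<in> borel_measurable M"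
        by measurable
    qed
    also have "(\<integral>\<^sup>+\<omega>. emeasure ?Q {\<rho> \<in> space ?Q. t < snd (step_map (\<omega>, \<rho>))} \<partial>M)
        = emeasure (step_law K) {z. t < snd z}"
      by (rule emeasure_step_law[OF K, symmetric]) measurable
    finally show ?thesis by simp
  qed
qed

text \<open>
  For \<open>v \<le> 1\<close> the root does not exceed \<open>1 / v\<close>, so \<open>v W \<le> 1\<close> holds iff it holds in each of the \<open>N\<close> subtrees; given
  the coefficients the subtrees are independent, and the coefficients are i.i.d.
\<close>
lemma tail_step_law:
  assumes K: "prob_space K" "sets K = sets borel" and v: "0 \<le> v" "v \<le> 1"
    and indep: "indep_vars (\<lambda>_. borel) A {1..N}"
    and ident: "\<forall>i\<in>{1..N}. distr M borel (A i) = distr M borel (A 1)"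
  shows "measure (step_law K) {z. 1 < v * snd z}
       = 1 - (1 - (\<integral>\<omega>. measure K {z. 1 < v * \<bar>A 1 \<omega>\<bar> * snd z} \<partial>M)) ^ N"
    and "(\<lambda>\<omega>. measure K {z. 1 < v * \<bar>A 1 \<omega>\<bar> * snd z}) \<in> borel_measurable M"
proof -
  let ?Q = "\<Pi>\<^sub>M i\<in>{1..N}. K"
  interpret K: prob_space K by fact
  interpret Q: prob_space ?Q by (intro prob_space_PiM K)
  interpret P: product_prob_space "\<lambda>_. K" by standard
  interpret S: prob_space "step_law K" by (rule prob_space_step_law[OF K])
  have spS: "space (step_law K) = UNIV" "sets (step_law K) = sets borel"
    by (simp_all add: step_law_def)
  have spK: "space K = UNIV" using sets_eq_imp_space_eq[OF K(2)] by simp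
  note [measurable] = fst_snd_measurable[OF K(2)]
  define g where "g a = measure K {z \<in> space K. v * \<bar>a\<bar> * snd z \<le> 1}" for a
  have g[measurable]: "g \<in> borel_measurable borel" unfolding g_def by measurable
  have g01: "0 \<le> g a" "g a \<le> 1" for a by (auto simp: g_def)
  have one: "1 \<in> {1..N}" using N_pos by simp
  have A1[measurable]: "A 1 \<in> borel_measurable M" using A_measurable[OF one] .
  have compl: "measure K {z. 1 < v * \<bar>a\<bar> * snd z} = 1 - g a" for a
  proof -
    have "{z. 1 < v * \<bar>a\<bar> * snd z} = space K - {z \<in> space K. v * \<bar>a\<bar> * snd z \<le> 1}" by (auto simp: spK)
    moreover have "{z \<in> space K. v * \<bar>a\<bar> * snd z \<le> 1} \<in> sets K" by measurable
    ultimately show ?thesis by (simp add: g_def K.prob_compl)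
  qed
  show "(\<lambda>\<omega>. measure K {z. 1 < v * \<bar>A 1 \<omega>\<bar> * snd z}) \<in> borel_measurable M"
    unfolding compl by measurable
  have int_g: "integrable M (\<lambda>\<omega>. g (A i \<omega>))" if "i \<in> {1..N}" for i
    by (rule integrable_const_bound[where B = 1]) (use g01 that in auto)
  have "emeasure (step_law K) {z. v * snd z \<le> 1} = (\<integral>\<^sup>+\<omega>. (\<Prod>i=1..N. ennreal (g (A i \<omega>))) \<partial>M)"
  proof -
    have "emeasure ?Q {\<rho> \<in> space ?Q. v * snd (step_map (\<omega>, \<rho>))
        \<le> 1} = (\<Prod>i=1..N. ennreal (g (A i \<omega>)))" for \<omega>
    proof -
      have "v * snd (step_map (\<omega>, \<rho>)) \<le> 1 \<longleftrightarrow> (\<forall>i\<in>{1..N}. v * \<bar>A i \<omega>\<bar> * snd (\<rho> i) \<le> 1)" for \<rho>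
      proof (cases "v = 0")
        case False
        then have "v > 0" using v by simp
        then have "v * x \<le> 1 \<longleftrightarrow> \<not> 1 / v < x" for x by (auto simp: field_simps)
        then show ?thesis using less_snd_step_map[of "1 / v" \<omega> \<rho>] v \<open>v > 0\<close>
          by (auto simp: mult.assoc)
      qed simp
      then have "{\<rho> \<in> space ?Q. v * snd (step_map (\<omega>, \<rho>))
          \<le> 1} = (\<Pi>\<^sub>E i\<in>{1..N}. {z \<in> space K. v * \<bar>A i \<omega>\<bar> * snd z \<le> 1})"
        by (auto simp: space_PiM PiE_def Pi_def spK)
      also have "emeasure ?Q \<dots> = (\<Prod>i=1..N. emeasure K {z \<in> space K. v * \<bar>A i \<omega>\<bar> * snd z \<le> 1})"
        by (rule P.emeasure_PiM) auto
      finally show ?thesis by (simp add: g_def K.emeasure_eq_measure)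
    qed
    then show ?thesis by (subst emeasure_step_law[OF K]) auto
  qed
  also have "\<dots> = (\<integral>\<^sup>+\<omega>. ennreal (\<Prod>i=1..N. g (A i \<omega>)) \<partial>M)"
    by (simp add: prod_ennreal g01)
  also have "\<dots> = ennreal (\<integral>\<omega>. (\<Prod>i=1..N. g (A i \<omega>)) \<partial>M)"
  proof (rule nn_integral_eq_integral)
    show "integrable M (\<lambda>\<omega>. \<Prod>i=1..N. g (A i \<omega>))"
      by (rule integrable_const_bound[where B = 1]) (auto simp: abs_prod g01 intro!: prod_le_1)
  qed (auto simp: g01 prod_nonneg)
  also have "(\<integral>\<omega>. (\<Prod>i=1..N. g (A i \<omega>)) \<partial>M) = (\<Prod>i=1..N. \<integral>\<omega>. g (A i \<omega>) \<partial>M)"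
    by (rule indep_vars_lebesgue_integral)
       (use indep_vars_compose2[OF indep, of "\<lambda>_. g" "\<lambda>_. borel"] int_g in auto)
  also have "\<dots> = (\<Prod>i=1..N. \<integral>\<omega>. g (A 1 \<omega>) \<partial>M)"
  proof (intro prod.cong refl)
    fix i assume i: "i \<in> {1..N}"
    have "(\<integral>\<omega>. g (A j \<omega>) \<partial>M) = (\<integral>x. g x \<partial>distr M borel (A j))" if "j \<in> {1..N}" for j
      using A_measurable[OF that] by (subst integral_distr) auto
    from this[OF i] this[OF one] bspec[OF ident i]
    show "(\<integral>\<omega>. g (A i \<omega>) \<partial>M) = (\<integral>\<omega>. g (A 1 \<omega>) \<partial>M)" by (simp only:)
  qed
  finally have *: "emeasure (step_law K) {z. v * snd z \<le> 1} = ennreal ((\<integral>\<omega>. g (A 1 \<omega>) \<partial>M) ^ N)" by simp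
  have "{z. 1 < v * snd z} = space (step_law K) - {z. v * snd z \<le> 1}" by (auto simp: spS)
  moreover have "{z. v * snd z \<le> 1} \<in> sets (step_law K)" by (simp add: spS)
  moreover have "measure (step_law K) {z. v * snd z \<le> 1} = (\<integral>\<omega>. g (A 1 \<omega>) \<partial>M) ^ N"
    using * by (simp add: measure_def g01)
  ultimately have "measure (step_law K) {z. 1 < v * snd z} = 1 - (\<integral>\<omega>. g (A 1 \<omega>) \<partial>M) ^ N"
    by (simp add: S.prob_compl)
  also have "(\<integral>\<omega>. g (A 1 \<omega>) \<partial>M) = 1 - (\<integral>\<omega>. 1 - g (A 1 \<omega>) \<partial>M)"
    using int_g[OF one] by (simp add: prob_space)
  finally show "measure (step_law K) {z. 1 < v * snd z}
       = 1 - (1 - (\<integral>\<omega>. measure K {z. 1 < v * \<bar>A 1 \<omega>\<bar> * snd z} \<partial>M)) ^ N"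
    unfolding compl .
qed

text \<open>
  The right-hand side of the fixed point equation depends only on the law of \<open>R\<close>, so \<open>R\<close> may be replaced by the
  first coordinate on the plane.
\<close>
lemma distr_smoothing_cong:
  fixes X :: "'b \<Rightarrow> real"
  assumes "prob_space M'" and [measurable]: "X \<in> borel_measurable M'"
  shows "distr (M \<Otimes>\<^sub>M (\<Pi>\<^sub>M i\<in>{1..N}. M')) borel (\<lambda>(\<omega>, \<rho>). (\<Sum>i=1..N. A i \<omega> * X (\<rho> i)) + B \<omega>)
       = distr (M \<Otimes>\<^sub>M (\<Pi>\<^sub>M i\<in>{1..N}. distr M' borel X)) borel (\<lambda>(\<omega>, x). (\<Sum>i=1..N. A i \<omega> * x i) + B \<omega>)"
proof -
  let ?I = "{1..N}" and ?L = "distr M' borel X"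
  let ?Q = "\<Pi>\<^sub>M i\<in>?I. M'" and ?P = "\<Pi>\<^sub>M i\<in>?I. ?L"
  interpret M': prob_space M' by fact
  interpret L: prob_space ?L by (rule M'.prob_space_distr) simp
  interpret P: prob_space ?P by (intro prob_space_PiM L.prob_space_axioms)
  have c[measurable]: "compose ?I X \<in> ?Q \<rightarrow>\<^sub>M ?P" unfolding compose_def by measurable
  have "?P = (\<Pi>\<^sub>M i\<in>?I. distr M' ?L X)" by (intro PiM_cong distr_cong) auto
  also have "\<dots> = distr ?Q ?P (compose ?I X)"
    by (rule distr_PiM_finite_prob_space'[symmetric])
       (auto intro: M'.prob_space_axioms L.prob_space_axioms)
  finally have P: "distr ?Q ?P (compose ?I X) = ?P" ..
  have "M \<Otimes>\<^sub>M ?P = distr M M (\<lambda>x. x) \<Otimes>\<^sub>M distr ?Q ?P (compose ?I X)" unfolding P by (simp add: distr_id2)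
  also have "\<dots> = distr (M \<Otimes>\<^sub>M ?Q) (M \<Otimes>\<^sub>M ?P) (\<lambda>(\<omega>, \<rho>). (\<omega>, compose ?I X \<rho>))"
    by (rule pair_measure_distr[OF measurable_ident_sets[OF refl] c])
        (unfold P, rule P.sigma_finite_measure_axioms)
  finally have eq: "M \<Otimes>\<^sub>M ?P = distr (M \<Otimes>\<^sub>M ?Q) (M \<Otimes>\<^sub>M ?P) (\<lambda>(\<omega>, \<rho>). (\<omega>, compose ?I X \<rho>))" .
  have "distr (M \<Otimes>\<^sub>M ?P) borel (\<lambda>(\<omega>, x). (\<Sum>i\<in>?I. A i \<omega> * x i) + B \<omega>)
     = distr (distr (M \<Otimes>\<^sub>M ?Q) (M \<Otimes>\<^sub>M ?P) (\<lambda>(\<omega>, \<rho>). (\<omega>, compose ?I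
         X \<rho>))) borel (\<lambda>(\<omega>, x). (\<Sum>i\<in>?I. A i \<omega> * x i) + B \<omega>)"
    using eq by simp
  also have "\<dots> = distr (M \<Otimes>\<^sub>M ?Q) borel ((\<lambda>(\<omega>, x). (\<Sum>i\<in>?I. A i \<omega> * x i)
      + B \<omega>) \<circ> (\<lambda>(\<omega>, \<rho>). (\<omega>, compose ?I X \<rho>)))"
    by (rule distr_distr) measurable
  also have "\<dots> = distr (M \<Otimes>\<^sub>M ?Q) borel (\<lambda>(\<omega>, \<rho>). (\<Sum>i\<in>?I. A i \<omega> * X (\<rho> i)) + B \<omega>)"
    by (intro distr_cong refl) (auto simp: compose_def)
  finally show ?thesis ..
qed

lemma fst_step_law:
  assumes K: "prob_space K" "sets K = sets borel"
    and M': "prob_space M'" "R \<in> borel_measurable M'"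
    and sol: "smoothing_solution M N A B M' R"
    and fst_K: "distr K borel fst = distr M' borel R"
  shows "distr (step_law K) borel fst = distr M' borel R"
proof -
  have "distr (step_law K) borel fst = distr (M \<Otimes>\<^sub>M (\<Pi>\<^sub>M i\<in>{1..N}. K)) borel (fst \<circ> step_map)"
    unfolding step_law_def using step_map_measurable[OF K(2)] by (simp add: distr_distr)
  also have "\<dots> = distr (M \<Otimes>\<^sub>M (\<Pi>\<^sub>M i\<in>{1..N}. K)) borel (\<lambda>(\<omega>, \<rho>). (\<Sum>i=1..N. A i \<omega> * fst (\<rho> i)) + B \<omega>)"
    by (intro distr_cong) (auto simp: step_map_def)
  also have "\<dots> = distr M' borel R"
    using distr_smoothing_cong[OF K(1) fst_snd_measurable(1)[OF
        K(2)]] distr_smoothing_cong[OF M'] sol fst_K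
    by (simp add: smoothing_solution_def)
  finally show ?thesis .
qed

section \<open>The two-sided lower bound\<close>

text \<open>
  The law of \<open>(R, W\<^sub>n)\<close> is built by iterating \<open>step_law\<close> on the law of \<open>(R, 1)\<close>. The coefficient \<open>2 c\<close> of
  \<open>v\<^sup>b\<close> is what makes the lower bound nonpositive on \<open>[0, 1]\<close> at \<open>n = 0\<close>: there both \<open>v\<^sup>\<alpha>\<close> and
  \<open>v\<^sup>p\<^sup>\<alpha>\<close> are at most \<open>v\<^sup>b\<close>.
\<close>
lemma coupled_laws_exist:
  fixes R :: "'b \<Rightarrow> real" and p \<alpha> b c q d :: real
  defines "I \<equiv> \<lambda>s. \<integral>\<omega>. \<bar>A 1 \<omega>\<bar> powr s \<partial>M"
  assumes indep: "indep_vars (\<lambda>_. borel) A {1..N}"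
    and ident: "\<forall>i\<in>{1..N}. distr M borel (A i) = distr M borel (A 1)"
    and M': "prob_space M'" "R \<in> borel_measurable M'" and sol: "smoothing_solution M N A B M' R"
    and spread: "\<And>y. emeasure (distr M' borel R) {x. \<bar>x - y\<bar> \<le> d} \<le> ennreal (1 - q)"
    and d: "0 < d" and q: "q \<le> 1"
    and p: "1 < p" "p \<le> 2" and pos: "0 < b" "b < \<alpha>" "0 < c"
    and int: "\<And>s. s \<in> {b, \<alpha>, p * \<alpha>, p\<^sup>2 * \<alpha>} \<Longrightarrow> integrable M (\<lambda>\<omega>. \<bar>A 1 \<omega>\<bar> powr s)"
    and one: "real N * I \<alpha> = 1"
    and small: "c powr p * (real N * (2 powr p * (I (p * \<alpha>) + I (p\<^sup>2 * \<alpha>)))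
                 + (real N)\<^sup>2 * (I \<alpha> + I (p * \<alpha>)) powr p) \<le> c * (real N * I (p * \<alpha>) - 1)"
  shows "\<exists>K. prob_space K \<and> sets K = sets borel \<and> distr K borel fst
      = distr M' borel R \<and> spread_pair q d K \<and>
     (\<forall>v\<ge>0. min 1 (c * (v powr \<alpha> + v powr (p * \<alpha>)) - 2 * c * (real N * I b) ^ n * v powr b)
              \<le> measure K {z. 1 < v * snd z})"
proof (induction n)
  case 0
  interpret M': prob_space M' by fact
  note [measurable] = M'(2)
  define K where "K = distr M' borel (\<lambda>x. (R x, 1 :: real))"
  have meas[measurable]: "(\<lambda>x. (R x, 1 :: real)) \<in> borel_measurable M'"
    by (simp add: borel_prod[symmetric])
  have K: "prob_space K" "sets K = sets borel" and spK: "space K = UNIV"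
    by (auto simp: K_def intro: M'.prob_space_distr)
  interpret K: prob_space K by fact
  have emK: "emeasure K {z. P z} = emeasure M' {x \<in> space M'. P (R x, 1)}"
      if [measurable]: "Measurable.pred borel P" for P
    unfolding K_def by (subst emeasure_distr) (auto intro!: arg_cong2[where f = emeasure])
  have "distr K borel fst = distr M' borel R"
    unfolding K_def by (subst distr_distr) (auto simp: comp_def)
  moreover have "spread_pair q d K"
    unfolding spread_pair_def
  proof (intro allI impI)
    fix t y :: real assume t: "0 < t"
    have 1: "emeasure K {z \<in> space K. \<bar>fst z - y\<bar> \<le> d * t \<and> t < snd z}
        = emeasure M' {x \<in> space M'. \<bar>R x - y\<bar> \<le> d * t \<and> t < 1}"
      and 2: "emeasure K {z \<in> space K. t < snd z} = emeasure M' {x \<in> space M'. t < 1}"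
      unfolding spK using emK[of "\<lambda>z. \<bar>fst z - y\<bar>
          \<le> d * t \<and> t < snd z"] emK[of "\<lambda>z. t < snd z"] by simp_all
    show "emeasure K {z \<in> space K. \<bar>fst z - y\<bar> \<le> d * t \<and> t < snd z}
        \<le> ennreal (1 - q) * emeasure K {z \<in> space K. t < snd z}"
    proof (cases "t < 1")
      case True
      then have "d * t \<le> d" using d by (simp add: mult_left_le)
      then have "emeasure M' {x \<in> space M'. \<bar>R x - y\<bar> \<le> d * t \<and> t < 1}
          \<le> emeasure M' {x \<in> space M'. \<bar>R x - y\<bar> \<le> d}"
        by (intro emeasure_mono) auto
      also have "\<dots> = emeasure (distr M' borel R) {x. \<bar>x - y\<bar> \<le> d}"
        by (subst emeasure_distr) (auto intro!: arg_cong2[where f = emeasure])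
      also note spread
      finally show ?thesis using True by (simp add: 1 2 M'.emeasure_space_1)
    qed (simp add: 1 2)
  qed
  moreover have "min 1 (c * (v powr \<alpha> + v powr (p * \<alpha>)) - 2 * c * (real N * I b) ^ 0 * v powr b)
              \<le> measure K {z. 1 < v * snd z}" if "0 \<le> v" for v
  proof (cases "v \<le> 1")
    case True
    have "v powr \<alpha> \<le> v powr b" "v powr (p * \<alpha>) \<le> v powr b"
    proof -
      have "b \<le> p * \<alpha>" using p pos mult_right_mono[of 1 p \<alpha>] by linarith
      then have "b \<le> s \<Longrightarrow> v powr s \<le> v powr b" for s
        using True that by (cases "v = 0") (auto intro!: powr_mono')
      then show "v powr \<alpha> \<le> v powr b" "v powr (p * \<alpha>) \<le> v powr b"
        using \<open>b \<le> p * \<alpha>\<close> pos by auto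
    qed
    then have "c * (v powr \<alpha> + v powr (p * \<alpha>)) \<le> c * (2 * v powr b)"
      using pos by (intro mult_left_mono) auto
    then show ?thesis by (simp add: min_le_iff_disj order_trans[OF _ measure_nonneg])
  next
    case False
    then have "emeasure K {z. 1 < v * snd z} = 1"
      by (subst emK) (auto simp: M'.emeasure_space_1)
    then show ?thesis by (simp add: measure_def)
  qed
  ultimately show ?case using K by blast
next
  case (Suc n)
  then obtain K where K: "prob_space K" "sets K
      = sets borel" and fst_K: "distr K borel fst = distr M' borel R"
    and spread_K: "spread_pair q d K"
    and tail_K: "\<And>v. 0 \<le> v \<Longrightarrow> min 1 (c * (v powr \<alpha> + v powr
        (p * \<alpha>)) - 2 * c * (real N * I b) ^ n * v powr b)
              \<le> measure K {z. 1 < v * snd z}" by blast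
  interpret K: prob_space K by fact
  have fst_S: "distr (step_law K) borel fst = distr M' borel R"
    by (rule fst_step_law[OF K M' sol fst_K])
  moreover have "spread_pair q d (step_law K)"
  proof (rule spread_pair_step_law[OF K spread_K])
    fix y
    have "emeasure (step_law K) {z. \<bar>fst z - y\<bar>
        \<le> d} = emeasure (distr (step_law K) borel fst) {x. \<bar>x - y\<bar> \<le> d}"
      by (subst emeasure_distr) (auto simp: step_law_def vimage_def)
    then show "emeasure (step_law K) {z. \<bar>fst z - y\<bar> \<le> d} \<le> ennreal (1 - q)"
      using spread by (simp add: fst_S)
  qed (use d q in auto)
  moreover have "min 1 (c * (v powr \<alpha> + v powr (p * \<alpha>)) - 2 * c * (real N * I b) ^ Suc n * v powr b)
              \<le> measure (step_law K) {z. 1 < v * snd z}" if v: "0 \<le> v" for v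
  proof (cases "v \<le> 1")
    case True
    let ?h = "\<lambda>\<omega>. measure K {z. 1 < v * \<bar>A 1 \<omega>\<bar> * snd z}"
    have "c * (v powr \<alpha> + v powr (p * \<alpha>)) - real N * I b * (2 * c * (real N * I b) ^ n) * v powr b
        \<le> 1 - (1 - (\<integral>\<omega>. ?h \<omega> \<partial>M)) ^ N"
      unfolding I_def
    proof (rule subsolution_step)
      show "prob_space M" by (rule prob_space_axioms)
      show "A 1 \<in> borel_measurable M" using N_pos by (intro A_measurable) auto
      show "?h \<in> borel_measurable M" by (rule tail_step_law(2)[OF K v True indep ident])
      show "0 \<le> 2 * c * (real N * (\<integral>\<omega>. \<bar>A 1 \<omega>\<bar> powr b \<partial>M)) ^ n" using pos by simp
      show "min 1 (c * ((v * \<bar>A 1 \<omega>\<bar>) powr \<alpha> + (v * \<bar>A 1 \<omega>\<bar>) powr (p * \<alpha>)) -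
          2 * c * (real N * (\<integral>\<omega>. \<bar>A 1 \<omega>\<bar> powr b \<partial>M)) ^ n * (v * \<bar>A 1 \<omega>\<bar>) powr b) \<le> ?h \<omega>" for \<omega>
        using tail_K[of "v * \<bar>A 1 \<omega>\<bar>"] v by (simp add: I_def)
    qed (use p pos v True int one small in \<open>simp_all add: I_def\<close>)
    also have "\<dots> = measure (step_law K) {z. 1 < v * snd z}"
      by (rule tail_step_law(1)[OF K v True indep ident, symmetric])
    finally show ?thesis by (simp add: min_le_iff_disj mult_ac)
  next
    case False
    have "emeasure (step_law K) {z. 1 < v * snd z} = 1"
    proof -
      have "1 < v * x \<longleftrightarrow> 1 / v < x" for x using False by (auto simp: field_simps)
      then have "1 < v * snd (step_map (\<omega>, \<rho>))" for \<omega> \<rho>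
        using False less_snd_step_map[of "1 / v" \<omega> \<rho>] by auto
      then show ?thesis
        by (subst emeasure_step_law[OF K])
           (auto simp: prob_space.emeasure_space_1[OF prob_space_PiM[OF K(1)]] emeasure_space_1)
    qed
    then show ?thesis by (simp add: measure_def)
  qed
  moreover have "prob_space (step_law K)" "sets (step_law K) = sets borel"
    using prob_space_step_law[OF K] by (auto simp: step_law_def)
  ultimately show ?case by blast
qed

text \<open>
  On \<open>W\<^sub>n > t\<close> the variable \<open>R\<close> leaves \<open>[-d t, d t]\<close> with conditional probability at least \<open>q\<close>, so
  \<open>\<P>(\<bar>R\<bar> > d t) \<ge> q \<P>(W\<^sub>n > t)\<close>. The left side does not depend on \<open>n\<close>, and letting \<open>n \<rightarrow> \<infinity>\<close> removes the
  negative term of the bound for \<open>\<P>(W\<^sub>n > t)\<close>.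
\<close>
lemma abs_tail_lower_bound:
  fixes R :: "'b \<Rightarrow> real" and p \<alpha> b :: real
  defines "I \<equiv> \<lambda>s. \<integral>\<omega>. \<bar>A 1 \<omega>\<bar> powr s \<partial>M"
  assumes indep: "indep_vars (\<lambda>_. borel) A {1..N}"
    and ident: "\<forall>i\<in>{1..N}. distr M borel (A i) = distr M borel (A 1)"
    and M': "prob_space M'" "R \<in> borel_measurable M'" and sol: "smoothing_solution M N A B M' R"
    and nt: "nontrivial_rv M' R"
    and p: "1 < p" "p \<le> 2" and pos: "0 < b" "b < \<alpha>"
    and int: "\<And>s. s \<in> {b, \<alpha>, p * \<alpha>, p\<^sup>2 * \<alpha>} \<Longrightarrow> integrable M (\<lambda>\<omega>. \<bar>A 1 \<omega>\<bar> powr s)"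
    and m_b: "real N * I b < 1" and m_\<alpha>: "real N * I \<alpha> = 1" and m_p: "1 < real N * I (p * \<alpha>)"
  shows "\<exists>C>0. \<exists>t0. \<forall>t\<ge>t0. C * t powr - \<alpha> \<le> \<P>(x in M'. t < \<bar>R x\<bar>)"
proof -
  interpret M': prob_space M' by fact
  note [measurable] = M'(2)
  obtain q d where q: "0 < q" "q \<le> 1" and d: "0 < d"
    and spread: "\<And>y. emeasure (distr M' borel R) {x. \<bar>x - y\<bar> \<le> d} \<le> ennreal (1 - q)"
    using M'.nontrivial_spread[OF M'(2) nt] by blast
  define D where "D = real N * (2 powr p * (I (p * \<alpha>)
      + I (p\<^sup>2 * \<alpha>))) + (real N)\<^sup>2 * (I \<alpha> + I (p * \<alpha>)) powr p"
  have I_nn: "0 \<le> I s" for s by (simp add: I_def)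
  have D: "0 \<le> D" using I_nn by (simp add: D_def)
  \<comment> \<open>The choice makes \<open>c\<^sup>p\<^sup>-\<^sup>1 (D + 1)\<close> equal to the gain \<open>m(p\<alpha>) - 1\<close>.\<close>
  define c where "c = ((real N * I (p * \<alpha>) - 1) / (D + 1)) powr (1 / (p - 1))"
  have c: "0 < c" using m_p D by (simp add: c_def)
  have small: "c powr p * D \<le> c * (real N * I (p * \<alpha>) - 1)"
  proof -
    have "c powr (p - 1) = (real N * I (p * \<alpha>) - 1) / (D + 1)"
      using p m_p D by (simp add: c_def powr_powr)
    moreover have "c powr p = c * c powr (p - 1)"
      using c powr_add[of c 1 "p - 1"] by simp
    ultimately have "c powr p * D = c * ((real N * I (p * \<alpha>) - 1) * (D / (D + 1)))" by simp
    also have "\<dots> \<le> c * ((real N * I (p * \<alpha>) - 1) * 1)"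
      using c m_p D by (intro mult_left_mono) auto
    finally show ?thesis by simp
  qed
  have bound: "q * min 1 (c * t powr - \<alpha>) \<le> \<P>(x in M'. d * t < \<bar>R x\<bar>)" if t: "1 \<le> t" for t
  proof -
    let ?v = "1 / t"
    define f where "f n = c * (?v powr \<alpha> + ?v powr
        (p * \<alpha>)) - 2 * c * (real N * I b) ^ n * ?v powr b" for n
    have *: "q * min 1 (f n) \<le> \<P>(x in M'. d * t < \<bar>R x\<bar>)" for n
    proof -
      obtain K where K: "prob_space K" "sets K = sets borel" "distr K borel fst = distr M' borel R"
        "spread_pair q d K" and tail: "\<And>v. 0 \<le> v \<Longrightarrow> min 1 (c * (v powr \<alpha>
            + v powr (p * \<alpha>)) - 2 * c * (real N * I b) ^ n * v powr b)
              \<le> measure K {z. 1 < v * snd z}"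
        using coupled_laws_exist[OF indep ident M' sol spread d q(2) p pos
            c int m_\<alpha>[unfolded I_def] small[unfolded D_def I_def], of n]
        unfolding I_def by blast
      interpret K: prob_space K by fact
      have spK: "space K = UNIV" using sets_eq_imp_space_eq[OF K(2)] by simp
      note [measurable] = fst_snd_measurable[OF K(2)]
      let ?W = "K.prob {z \<in> space K. t < snd z}"
      have "f n \<le> 1 \<Longrightarrow> f n \<le> ?W" "1 \<le> f n \<Longrightarrow> 1 \<le> ?W"
        using tail[of ?v] t by (auto simp: f_def spK min_def field_simps split: if_splits)
      then have W: "min 1 (f n) \<le> ?W" by linarith
      have le: "K.prob {z \<in> space K. \<bar>fst z - 0\<bar> \<le> d * t \<and> t < snd z} \<le> (1 - q) * ?W"
        using K(4)[unfolded spread_pair_def, rule_format, of t 0] t q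
        by (simp add: K.emeasure_eq_measure flip: ennreal_mult)
      have "\<P>(x in M'. \<bar>R x\<bar> \<le> d * t) = measure (distr K borel fst) {r. \<bar>r\<bar> \<le> d * t}"
        unfolding K(3) by (subst measure_distr) (auto intro!: arg_cong2[where f = measure])
      also have "\<dots> = K.prob {z \<in> space K. \<bar>fst z\<bar> \<le> d * t}"
        by (subst measure_distr) (auto intro!: arg_cong2[where f = measure])
      also have "\<dots> \<le> K.prob ({z \<in> space K. \<bar>fst z - 0\<bar>
          \<le> d * t \<and> t < snd z} \<union> {z \<in> space K. \<not> t < snd z})"
        by (rule K.finite_measure_mono) auto
      also have "\<dots> \<le> K.prob {z \<in> space K. \<bar>fst z - 0\<bar>
          \<le> d * t \<and> t < snd z} + K.prob {z \<in> space K. \<not> t < snd z}"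
        by (rule measure_Un_le) auto
      also have "K.prob {z \<in> space K. \<not> t < snd z} = 1 - ?W"
        by (rule K.prob_neg) measurable
      finally have "\<P>(x in M'. \<bar>R x\<bar> \<le> d * t) \<le> 1 - q * ?W" using le by (simp add: algebra_simps)
      moreover have "\<P>(x in M'. \<not> \<bar>R x\<bar> \<le> d * t) = 1 - \<P>(x in M'. \<bar>R x\<bar> \<le> d * t)"
        by (rule M'.prob_neg) measurable
      moreover have "q * min 1 (f n) \<le> q * ?W" using W q by (intro mult_left_mono) auto
      ultimately show ?thesis by (simp add: not_le)
    qed
    have lim: "(\<lambda>n. (real N * I b) ^ n) \<longlonglongrightarrow> 0"
      using m_b I_nn by (intro LIMSEQ_realpow_zero) auto
    have "(\<lambda>n. q * min 1 (f n)) \<longlonglongrightarrow> q * min 1 (c * (?v powr \<alpha> + ?v powr (p * \<alpha>)) - 2 * c * 0 * ?v powr b)"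
      unfolding f_def by (intro tendsto_mult tendsto_min tendsto_diff tendsto_const lim)
    then have "q * min 1 (c * (?v powr \<alpha> + ?v powr (p * \<alpha>)) - 2 * c * 0 * ?v powr b)
        \<le> \<P>(x in M'. d * t < \<bar>R x\<bar>)"
      by (rule LIMSEQ_le_const2) (use * in auto)
    moreover have "c * t powr - \<alpha> \<le> c * (?v powr \<alpha> + ?v powr (p * \<alpha>))"
    proof (intro mult_left_mono)
      have "?v powr \<alpha> = t powr - \<alpha>" using t by (simp add: powr_divide powr_minus_divide)
      then show "t powr - \<alpha> \<le> ?v powr \<alpha> + ?v powr (p * \<alpha>)" by simp
    qed (use c in auto)
    moreover have "q * min 1 (c * t powr - \<alpha>) \<le> q * min 1 (c * (?v powr \<alpha> + ?v powr (p * \<alpha>)))"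
      using calculation(2) q by (intro mult_left_mono) auto
    ultimately show ?thesis by simp
  qed
  show ?thesis
  proof (intro exI conjI allI impI)
    show "0 < q * min 1 c * d powr \<alpha>" using q c d by simp
    fix t assume "d \<le> t"
    then have t: "1 \<le> t / d" using d by simp
    have "(t / d) powr - \<alpha> \<le> 1 powr - \<alpha>" using t pos by (intro powr_mono2') auto
    then have "min 1 c * (t / d) powr - \<alpha> \<le> 1 * 1"
      by (intro mult_mono) auto
    moreover have "min 1 c * (t / d) powr - \<alpha> \<le> c * (t / d) powr - \<alpha>"
      by (intro mult_right_mono) auto
    ultimately have "q * (min 1 c * (t / d) powr - \<alpha>) \<le> q * min 1 (c * (t / d) powr - \<alpha>)"
      using q by (intro mult_left_mono) auto
    also have "\<dots> \<le> \<P>(x in M'. d * (t / d) < \<bar>R x\<bar>)" by (rule bound[OF t])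
    also have "(t / d) powr - \<alpha> = t powr - \<alpha> * d powr \<alpha>"
      using t d by (simp add: powr_divide powr_minus field_simps)
    finally show "q * min 1 c * d powr \<alpha> * t powr - \<alpha> \<le> \<P>(x in M'. t < \<bar>R x\<bar>)"
      using d by (simp add: mult_ac)
  qed
qed

section \<open>From the absolute value to each tail\<close>

text \<open>
  The event \<open>G n\<close> says that \<open>\<sigma> A\<^sub>1 > 1 / (n + 1)\<close> while the sum \<open>S\<close> of all terms other than \<open>A\<^sub>1 R\<^sub>1\<close> is at most
  \<open>n\<close> in absolute value; it has positive probability for some \<open>n\<close>. It is independent of \<open>R\<^sub>1\<close>, and if also
  \<open>\<sigma> R\<^sub>1 > (n + 1)\<^sup>2 t\<close>, then \<open>A\<^sub>1 R\<^sub>1 + S > (n + 1) t - n \<ge> t\<close> for \<open>t \<ge> 1\<close>.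
\<close>
lemma one_step_tail:
  fixes R :: "'b \<Rightarrow> real" and \<sigma> :: real
  assumes M': "prob_space M'" and R[measurable]: "R \<in> borel_measurable M'"
    and sol: "smoothing_solution M N A B M' R"
    and \<sigma>: "\<sigma> = 1 \<or> \<sigma> = -1" and pos: "\<P>(\<omega> in M. 0 < \<sigma> * A 1 \<omega>) > 0"
  shows "\<exists>\<eta>>0. \<exists>L>0. \<forall>t\<ge>1. \<eta> * \<P>(x in M'. L * t < \<sigma> * R x) \<le> \<P>(x in M'. t < R x)"
proof -
  interpret M': prob_space M' by fact
  let ?J = "{2..N}" and ?L = "distr M' borel R"
  have ins: "{1..N} = insert 1 ?J" using N_pos by auto
  interpret L: prob_space ?L by (rule M'.prob_space_distr) simp
  interpret P: product_prob_space "\<lambda>_. ?L" by standard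
  let ?Q = "PiM ?J (\<lambda>_. ?L)"
  interpret Q: prob_space ?Q by (intro prob_space_PiM L.prob_space_axioms)
  interpret P1: prob_space "PiM {1..N} (\<lambda>_. ?L)" by (intro prob_space_PiM L.prob_space_axioms)
  interpret MQ: pair_prob_space M ?Q ..
  have A1[measurable]: "A 1 \<in> borel_measurable M" using N_pos by (intro A_measurable) auto
  note A1[unfolded One_nat_def, measurable]
  have AJ[measurable]: "A i \<in> borel_measurable M"
      if "i \<in> ?J" for i using that by (intro A_measurable) auto
  define S where "S = (\<lambda>p. (\<Sum>i\<in>?J. A i (fst p) * snd p i) + B (fst p))"
  have S[measurable]: "S \<in> borel_measurable (M \<Otimes>\<^sub>M ?Q)" unfolding S_def by measurable
  define G where "G n = {p \<in> space (M \<Otimes>\<^sub>M ?Q). 1 / real (Suc n) < \<sigma> * A 1 (fst p) \<and> \<bar>S p\<bar>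
      \<le> real n}" for n :: nat
  have G[measurable]: "G n \<in> sets (M \<Otimes>\<^sub>M ?Q)" for n unfolding G_def by measurable
  have "\<exists>n. MQ.prob (G n) \<noteq> 0"
  proof (rule ccontr)
    assume "\<not> ?thesis"
    then have "AE p in M \<Otimes>\<^sub>M ?Q. \<forall>n. p \<notin> G n"
      unfolding AE_all_countable
      by (auto intro!: AE_not_in simp: null_sets_def MQ.emeasure_eq_measure)
    then have "AE p in M \<Otimes>\<^sub>M ?Q. \<not> 0 < \<sigma> * A 1 (fst p)"
      using AE_space
    proof eventually_elim
      case (elim p)
      show ?case
      proof
        assume "0 < \<sigma> * A 1 (fst p)"
        then obtain n1 where n1: "1 / real (Suc n1) < \<sigma> * A 1 (fst p)" by (rule nat_approx_posE)
        obtain n2 where n2: "\<bar>S p\<bar> \<le> real n2" by (meson real_arch_simple)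
        have "1 / real (Suc (max n1 n2)) \<le> 1 / real (Suc n1)" by (intro divide_left_mono) auto
        moreover have "real n2 \<le> real (max n1 n2)" by simp
        ultimately have "p \<in> G (max n1 n2)"
          unfolding G_def mem_Collect_eq using n1 n2 elim by (intro conjI) linarith+
        with elim show False by blast
      qed
    qed
    then have "AE \<omega> in M. AE x in ?Q. \<not> 0 < \<sigma> * A 1 \<omega>"
      using MQ.AE_pair by fastforce
    then have "AE \<omega> in M. \<not> 0 < \<sigma> * A 1 \<omega>" by simp
    then have "\<P>(\<omega> in M. 0 < \<sigma> * A 1 \<omega>) = 0" by (subst prob_eq_0) auto
    with pos show False by simp
  qed
  then obtain n where n: "0 < MQ.prob (G n)" by (auto simp: zero_less_measure_iff)
  define l where "l = (real n + 1)\<^sup>2"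
  have "MQ.prob (G n) * \<P>(x in M'. l * t < \<sigma> * R x) \<le> \<P>(x in M'. t < R x)" if t: "1 \<le> t" for t
  proof -
    let ?E = "\<lambda>\<omega>. {x \<in> space (PiM {1..N} (\<lambda>_. ?L)). t < (\<Sum>i=1..N. A i \<omega> * x i) + B \<omega>}"
    let ?H = "{r \<in> space ?L. l * t < \<sigma> * r}"
    have key: "(\<integral>\<^sup>+x. indicator (G n) (\<omega>, x) * emeasure ?L ?H \<partial>?Q)
        \<le> emeasure (PiM {1..N} (\<lambda>_. ?L)) (?E \<omega>)" for \<omega>
    proof -
      have E: "?E \<omega> \<in> sets (PiM {1..N} (\<lambda>_. ?L))" by measurable
      have "(\<integral>\<^sup>+x. indicator (G n) (\<omega>, x) * emeasure ?L ?H \<partial>?Q)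
          = (\<integral>\<^sup>+x. (\<integral>\<^sup>+r. indicator (G n) (\<omega>, x) * indicator ?H r \<partial>?L) \<partial>?Q)"
        by (intro nn_integral_cong, subst nn_integral_cmult) auto
      also have "\<dots> \<le> (\<integral>\<^sup>+x. (\<integral>\<^sup>+r. indicator (?E \<omega>) (x(1 := r)) \<partial>?L) \<partial>?Q)"
      proof (intro nn_integral_mono)
        fix x r assume x: "x \<in> space ?Q" and r: "r \<in> space ?L"
        have "x(1 := r) \<in> ?E \<omega>" if "(\<omega>, x) \<in> G n" "r \<in> ?H"
        proof -
          from that have a: "1 / real (Suc n) < \<sigma> * A 1 \<omega>" and s: "\<bar>S (\<omega>, x)\<bar>
              \<le> real n" and h: "l * t < \<sigma> * r"
            by (auto simp: G_def)
          have "(real n + 1) * t = 1 / real (Suc n) * (l * t)"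
            by (simp add: l_def power2_eq_square field_simps)
          also have "\<dots> < (\<sigma> * A 1 \<omega>) * (\<sigma> * r)"
          proof (rule mult_strict_mono[OF a h])
            have "0 < 1 / real (Suc n)" by simp
            with a show "0 < \<sigma> * A 1 \<omega>" by linarith
            show "0 \<le> l * t" using t by (simp add: l_def)
          qed
          also have "\<dots> = A 1 \<omega> * r" using \<sigma> by auto
          finally have "(real n + 1) * t < A 1 \<omega> * r" .
          moreover have "t + real n \<le> (real n + 1) * t"
            using t mult_left_mono[of 1 t "real n"] by (simp add: algebra_simps)
          moreover have "(\<Sum>i=1..N. A i \<omega> * (x(1 := r)) i) = A 1 \<omega> * r + (\<Sum>i\<in>?J. A i \<omega> * x i)"
            unfolding ins by (subst sum.insert) (auto intro!: sum.cong)
          ultimately have "t < (\<Sum>i=1..N. A i \<omega> * (x(1 := r)) i) + B \<omega>"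
            using s unfolding S_def by simp
          moreover have "x(1 := r) \<in> space (PiM {1..N} (\<lambda>_. ?L))"
            using x unfolding ins by (auto simp: space_PiM PiE_def extensional_def)
          ultimately show ?thesis by blast
        qed
        then show "indicator (G n) (\<omega>, x) * indicator ?H r \<le> (indicator (?E \<omega>) (x(1 := r)) :: ennreal)"
          by (auto simp: indicator_def)
      qed
      also have "\<dots> = (\<integral>\<^sup>+x. indicator (?E \<omega>) x \<partial>PiM {1..N} (\<lambda>_. ?L))"
        using E unfolding ins by (intro P.product_nn_integral_insert[symmetric]) auto
      also have "\<dots> = emeasure (PiM {1..N} (\<lambda>_. ?L)) (?E \<omega>)"
        using E by (rule nn_integral_indicator)
      finally show ?thesis .
    qed
    have "emeasure (M \<Otimes>\<^sub>M ?Q) (G n) * emeasure ?L ?H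
        = (\<integral>\<^sup>+\<omega>. (\<integral>\<^sup>+x. indicator (G n) (\<omega>, x) * emeasure ?L ?H \<partial>?Q) \<partial>M)"
      by (subst Q.emeasure_pair_measure[OF G], subst nn_integral_multc[symmetric])
         (auto intro!: nn_integral_cong nn_integral_multc[symmetric])
    also have "\<dots> \<le> (\<integral>\<^sup>+\<omega>. emeasure (PiM {1..N} (\<lambda>_. ?L)) (?E \<omega>) \<partial>M)"
      by (intro nn_integral_mono key)
    also have "\<dots> = emeasure (M \<Otimes>\<^sub>M PiM {1..N} (\<lambda>_. ?L)) {p \<in> space (M \<Otimes>\<^sub>M PiM {1..N}
        (\<lambda>_. ?L)). t < (\<Sum>i=1..N. A i (fst p) * snd p i) + B (fst p)}"
      by (subst P1.emeasure_pair_measure_alt)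
         (measurable, auto intro!: nn_integral_cong arg_cong2[where f
             = emeasure] simp: space_pair_measure)
    also have "\<dots> = emeasure (distr (M \<Otimes>\<^sub>M PiM {1..N} (\<lambda>_. ?L)) borel
        (\<lambda>(\<omega>, x). (\<Sum>i=1..N. A i \<omega> * x i) + B \<omega>)) {r. t < r}"
      by (subst emeasure_distr) (measurable, auto intro!: arg_cong2[where f = emeasure])
    also have "\<dots> = emeasure ?L {r. t < r}"
      using distr_smoothing_cong[OF M' R] sol by (simp add: smoothing_solution_def)
    also have "emeasure ?L {r. t < r} = \<P>(x in M'. t < R x)"
      by (subst emeasure_distr) (auto simp: M'.emeasure_eq_measure intro!: arg_cong[where f = M'.prob])
    also have "emeasure ?L ?H = \<P>(x in M'. l * t < \<sigma> * R x)"
      by (subst emeasure_distr) (auto simp: M'.emeasure_eq_measure intro!: arg_cong[where f = M'.prob])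
    finally show ?thesis by (simp add: MQ.emeasure_eq_measure flip: ennreal_mult)
  qed
  moreover have "0 < l" by (simp add: l_def)
  ultimately show ?thesis using n by blast
qed

text \<open>
  The event \<open>\<bar>R\<bar> > L t\<close> splits into \<open>R > L t\<close> and \<open>- R > L t\<close>; a coefficient \<open>A\<^sub>1 > 0\<close> carries the first
  to the right tail of \<open>R\<close>, and a coefficient \<open>A\<^sub>1 < 0\<close> carries the second.
\<close>
lemma right_tail_from_abs_tail:
  fixes R :: "'b \<Rightarrow> real" and C \<alpha> :: real
  assumes M': "prob_space M'" and R[measurable]: "R \<in> borel_measurable M'"
    and sol: "smoothing_solution M N A B M' R"
    and pos: "\<P>(\<omega> in M. A 1 \<omega> > 0) > 0" and neg: "\<P>(\<omega> in M. A 1 \<omega> < 0) > 0"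
    and tail: "0 < C" "\<And>t. t0 \<le> t \<Longrightarrow> C * t powr - \<alpha> \<le> \<P>(x in M'. t < \<bar>R x\<bar>)"
  shows "Liminf at_top (\<lambda>t::real. ereal (t powr \<alpha> * \<P>(x in M'. R x > t))) > 0"
proof -
  interpret M': prob_space M' by fact
  obtain \<eta>1 L1 where 1: "0 < \<eta>1" "0 < L1" "\<And>t. 1
      \<le> t \<Longrightarrow> \<eta>1 * \<P>(x in M'. L1 * t < 1 * R x) \<le> \<P>(x in M'. t < R x)"
    using one_step_tail[OF M' R sol, of 1] pos by auto
  obtain \<eta>2 L2 where 2: "0 < \<eta>2" "0 < L2" "\<And>t. 1
      \<le> t \<Longrightarrow> \<eta>2 * \<P>(x in M'. L2 * t < -1 * R x) \<le> \<P>(x in M'. t < R x)"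
    using one_step_tail[OF M' R sol, of "-1"] neg by auto
  define L where "L = max L1 L2"
  have L: "0 < L" using 1 by (simp add: L_def)
  define \<kappa> where "\<kappa> = C * L powr - \<alpha> / (1 / \<eta>1 + 1 / \<eta>2)"
  have \<kappa>: "0 < \<kappa>" using 1 2 L tail(1) by (simp add: \<kappa>_def add_pos_pos)
  have bound: "\<kappa> \<le> t powr \<alpha> * \<P>(x in M'. R x > t)" if t: "1 \<le> t" "t0 / L \<le> t" for t
  proof -
    let ?p = "\<P>(x in M'. t < R x)"
    have "C * (L * t) powr - \<alpha> \<le> \<P>(x in M'. L * t < \<bar>R x\<bar>)"
      using t L by (intro tail(2)) (simp add: field_simps)
    also have "\<dots> \<le> M'.prob ({x \<in> space M'. L1 * t < 1 * R x} \<union> {x \<in> space M'. L2 * t < -1 * R x})"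
    proof (rule M'.finite_measure_mono)
      have "L1 * t \<le> L * t" "L2 * t \<le> L * t" using t by (auto simp: L_def)
      then show "{x \<in> space M'. L * t < \<bar>R x\<bar>} \<subseteq> {x \<in> space M'. L1
          * t < 1 * R x} \<union> {x \<in> space M'. L2 * t < -1 * R x}"
        by auto
    qed measurable
    also have "\<dots> \<le> \<P>(x in M'. L1 * t < 1 * R x) + \<P>(x in M'. L2 * t < -1 * R x)"
      by (rule measure_Un_le) measurable
    also have "\<dots> \<le> ?p / \<eta>1 + ?p / \<eta>2"
      using 1(1) 1(3)[OF t(1)] 2(1) 2(3)[OF t(1)]
      by (intro add_mono) (simp_all add: pos_le_divide_eq mult.commute)
    also have "\<dots> = (1 / \<eta>1 + 1 / \<eta>2) * ?p" by (simp add: algebra_simps)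
    finally have "C * (L powr - \<alpha> * t powr - \<alpha>) \<le> (1 / \<eta>1 + 1 / \<eta>2) * ?p"
      using t L by (simp add: powr_mult)
    then have "C * (L powr - \<alpha> * t powr - \<alpha>) * t powr \<alpha> \<le> (1 / \<eta>1 + 1 / \<eta>2) * ?p * t powr \<alpha>"
      by (intro mult_right_mono) auto
    also have "(1 / \<eta>1 + 1 / \<eta>2) * ?p * t powr \<alpha> = (t powr \<alpha> * ?p) * (1 / \<eta>1 + 1 / \<eta>2)"
      by (simp only: mult_ac)
    also have "C * (L powr - \<alpha> * t powr - \<alpha>) * t powr \<alpha> = C * L powr - \<alpha>"
      using t by (simp add: powr_minus)
    finally have "C * L powr - \<alpha> \<le> (t powr \<alpha> * ?p) * (1 / \<eta>1 + 1 / \<eta>2)" .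
    then show ?thesis unfolding \<kappa>_def using 1 2
      by (subst pos_divide_le_eq) (auto intro: add_pos_pos)
  qed
  have "ereal \<kappa> \<le> Liminf at_top (\<lambda>t::real. ereal (t powr \<alpha> * \<P>(x in M'. R x > t)))"
  proof (rule Liminf_bounded)
    show "\<forall>\<^sub>F t in at_top. ereal \<kappa> \<le> ereal (t powr \<alpha> * \<P>(x in M'. R x > t))"
      using eventually_ge_at_top[of 1] eventually_ge_at_top[of "t0 / L"]
      by eventually_elim (use bound in auto)
  qed
  then show ?thesis using \<kappa> by (auto intro: less_le_trans[of 0 "ereal \<kappa>"])
qed
end

lemma smoothing_solution_uminus:
  fixes R :: "'b \<Rightarrow> real"
  assumes "smoothing_coefficients M N A B" and [measurable]: "R \<in> borel_measurable M'"
    and sol: "smoothing_solution M N A B M' R"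
  shows "smoothing_solution M N A (\<lambda>\<omega>. - B \<omega>) M' (\<lambda>x. - R x)"
proof -
  interpret smoothing_coefficients M N A B by fact
  let ?T = "\<lambda>(\<omega>, \<rho>). (\<Sum>i=1..N. A i \<omega> * R (\<rho> i)) + B \<omega>"
  have T[measurable]: "?T \<in> borel_measurable (M \<Otimes>\<^sub>M (\<Pi>\<^sub>M i\<in>{1..N}. M'))" by measurable
  have "distr M' borel (\<lambda>x. - R x) = distr (distr M' borel R) borel uminus"
    by (subst distr_distr) (auto simp: comp_def)
  also have "\<dots> = distr (M \<Otimes>\<^sub>M (\<Pi>\<^sub>M i\<in>{1..N}. M')) borel (uminus \<circ> ?T)"
    unfolding sol[unfolded smoothing_solution_def] by (subst distr_distr[OF _ T]) auto
  also have "\<dots> = distr (M \<Otimes>\<^sub>M (\<Pi>\<^sub>M i\<in>{1..N}. M')) borel (\<lambda>(\<omega>, \<rho>). (\<Sum>i=1..N. A i \<omega> * - R (\<rho> i)) + - B \<omega>)"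
    by (intro distr_cong refl) (auto simp: sum_negf)
  finally show ?thesis unfolding smoothing_solution_def .
qed

theorem theorem1p1:
  fixes M :: "'a measure" and M' :: "'b measure"
    and N :: nat
    and A :: "nat \<Rightarrow> 'a \<Rightarrow> real" and B :: "'a \<Rightarrow> real" and R :: "'b \<Rightarrow> real"
    and \<gamma> \<alpha> \<epsilon> :: real
  assumes "prob_space M" and "prob_space M'"
    and "N > 1"
    and A_indep: "prob_space.indep_vars M (\<lambda>_. borel) A {1..N}"
    and A_ident: "\<forall>i\<in>{1..N}. distr M borel (A i) = distr M borel (A 1)"
    and B_rv: "B \<in> borel_measurable M"
    and nonlattice: "nonlattice_log_abs M (A 1)"
    and pos: "\<P>(\<omega> in M. A 1 \<omega> > 0) > 0" and neg: "\<P>(\<omega> in M. A 1 \<omega> < 0) > 0"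
    and s1_pos: "smoothing_s1 M N A > 0"
    and exponents: "0 < \<gamma>" "\<gamma> < \<alpha>" "ereal \<alpha> < smoothing_s1 M N A"
    and m_eq_1: "smoothing_m M N A \<gamma> = 1" "smoothing_m M N A \<alpha> = 1"
    and eps: "\<epsilon> > 0"
    and B_moment: "(\<integral>\<^sup>+\<omega>. ennreal (\<bar>B \<omega>\<bar> powr (\<gamma> + \<epsilon>)) \<partial>M) < \<infinity>"
    and R_rv: "R \<in> borel_measurable M'"
    and R_solution: "smoothing_solution M N A B M' R"
    and R_nontrivial: "nontrivial_rv M' R"
    and R_moment: "(\<integral>\<^sup>+\<omega>. ennreal (\<bar>R \<omega>\<bar> powr (\<gamma> + \<epsilon>)) \<partial>M') < \<infinity>"
  shows "Liminf at_top (\<lambda>t::real. ereal (t powr \<alpha> * \<P>(\<omega> in M'. R \<omega> > t))) > 0 \<and>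
         Liminf at_top (\<lambda>t::real. ereal (t powr \<alpha> * \<P>(\<omega> in M'. R \<omega> < - t))) > 0"
proof -
  interpret M: prob_space M by fact
  interpret M': prob_space M' by fact
  have A_meas: "A i \<in> borel_measurable M" if "i \<in> {1..N}" for i
    using A_indep that by (auto simp: M.indep_vars_def)
  have coeff: "smoothing_coefficients M N A B"
    using \<open>N > 1\<close> A_meas B_rv by unfold_locales auto
  have coeff': "smoothing_coefficients M N A (\<lambda>\<omega>. - B \<omega>)"
    using \<open>N > 1\<close> A_meas B_rv by unfold_locales auto
  interpret smoothing_coefficients M N A B by fact
  interpret refl: smoothing_coefficients M N A "\<lambda>\<omega>. - B \<omega>" by fact
  have A1[measurable]: "A 1 \<in> borel_measurable M" using \<open>N > 1\<close> by (intro A_meas) auto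
  note A1[unfolded One_nat_def, measurable]
  define I where "I s = (\<integral>\<omega>. \<bar>A 1 \<omega>\<bar> powr s \<partial>M)" for s
  have int: "integrable M (\<lambda>\<omega>. \<bar>A 1 \<omega>\<bar> powr s)"
    and m: "smoothing_m M N A s = ennreal (real N * I s)" if "smoothing_m M N A s < \<infinity>" for s
  proof -
    have eq: "smoothing_m M N A s = of_nat N * (\<integral>\<^sup>+\<omega>. ennreal (\<bar>A 1 \<omega>\<bar> powr s) \<partial>M)"
      by (rule smoothing_m_identically_distributed[OF A_meas A_ident])
    with that \<open>N > 1\<close> have "(\<integral>\<^sup>+\<omega>. ennreal (\<bar>A 1 \<omega>\<bar> powr s) \<partial>M) < \<infinity>"
      by (auto simp: ennreal_mult_less_top of_nat_less_top)
    moreover have "(\<lambda>\<omega>. \<bar>A 1 \<omega>\<bar> powr s) \<in> borel_measurable M"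
      by measurable
    ultimately show 1: "integrable M (\<lambda>\<omega>. \<bar>A 1 \<omega>\<bar> powr s)"
      by (intro integrableI_bounded) simp_all
    then show "smoothing_m M N A s = ennreal (real N * I s)"
      unfolding eq I_def by (subst nn_integral_eq_integral[OF 1])
          (auto simp: ennreal_mult ennreal_of_nat_eq_real_of_nat)
  qed
  have I_\<gamma>: "real N * I \<gamma> = 1" and I_\<alpha>: "real N * I \<alpha> = 1"
    using m[of \<gamma>] m[of \<alpha>] m_eq_1 by (simp_all add: ennreal_eq_1)
  have int_\<gamma>: "integrable M (\<lambda>\<omega>. \<bar>A 1 \<omega>\<bar> powr \<gamma>)" and int_\<alpha>: "integrable M (\<lambda>\<omega>. \<bar>A 1 \<omega>\<bar> powr \<alpha>)"
    using int m_eq_1 by simp_all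
  obtain s where s: "\<alpha> < s" "smoothing_m M N A s < \<infinity>"
    using exponents(3) unfolding smoothing_s1_def less_SUP_iff by auto
  \<comment> \<open>Otherwise \<open>ln \<bar>A\<^sub>1\<bar>\<close> would vanish where defined, and hence lie in the lattice \<open>\<int>\<close>.\<close>
  have nd: "\<not> (AE \<omega> in M. A 1 \<omega> = 0 \<or> \<bar>A 1 \<omega>\<bar> = 1)"
  proof
    assume "AE \<omega> in M. A 1 \<omega> = 0 \<or> \<bar>A 1 \<omega>\<bar> = 1"
    then have "AE \<omega> in M. A 1 \<omega> \<noteq> 0 \<longrightarrow> ln \<bar>A 1 \<omega>\<bar> \<in> {0 + 1 * real_of_int k | k. True}"
      by eventually_elim (auto intro: exI[of _ "0 :: int"])
    with nonlattice show False unfolding nonlattice_log_abs_def by (meson zero_less_one)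
  qed
  define b where "b = (\<gamma> + \<alpha>) / 2"
  \<comment> \<open>Any \<open>p\<close> in \<open>(1, 2]\<close> with \<open>p\<^sup>2 \<alpha> \<le> s\<close> serves; then the moments of orders in \<open>[\<gamma>, p\<^sup>2 \<alpha>]\<close> are finite.\<close>
  define p where "p = min 2 (sqrt (s / \<alpha>))"
  have \<alpha>: "0 < \<alpha>" using exponents by simp
  have b: "\<gamma> < b" "b < \<alpha>" using exponents by (auto simp: b_def)
  have p: "1 < p" "p \<le> 2" using s \<alpha> by (auto simp: p_def)
  have p2: "p\<^sup>2 * \<alpha> \<le> s"
  proof -
    have "p\<^sup>2 \<le> (sqrt (s / \<alpha>))\<^sup>2" using p by (intro power_mono) (auto simp: p_def)
    also have "\<dots> = s / \<alpha>" using s \<alpha> by simp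
    finally show ?thesis using \<alpha> by (simp add: field_simps)
  qed
  have p_less: "\<alpha> < p * \<alpha>" "p * \<alpha> < p\<^sup>2 * \<alpha>"
    using p \<alpha> by (simp_all add: power2_eq_square)
  have int': "integrable M (\<lambda>\<omega>. \<bar>A 1 \<omega>\<bar> powr r)" if "r \<in> {b, \<alpha>, p * \<alpha>, p\<^sup>2 * \<alpha>}" for r
    by (rule integrable_powr_between[OF int_\<gamma> int[OF s(2)]]) (use that b p_less p2 in auto)
  have m_b: "real N * I b < 1"
  proof -
    have "(\<alpha> - \<gamma>) * I b < (\<alpha> - b) * I \<gamma> + (b - \<gamma>) * I \<alpha>"
      unfolding I_def using b nd by (intro moment_strict_interpolation int_\<gamma> int_\<alpha>) auto
    then have "real N * ((\<alpha> - \<gamma>) * I b) < real N * ((\<alpha> - b) * I \<gamma> + (b - \<gamma>) * I \<alpha>)"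
      using \<open>N > 1\<close> by (intro mult_strict_left_mono) auto
    also have "\<dots> = (\<alpha> - b) * (real N * I \<gamma>) + (b - \<gamma>) * (real N * I \<alpha>)" by algebra
    finally have "(\<alpha> - \<gamma>) * (real N * I b) < (\<alpha> - \<gamma>) * 1"
      unfolding I_\<gamma> I_\<alpha> by (simp add: mult_ac)
    then show ?thesis using exponents(2) by (simp add: mult_less_cancel_left_pos)
  qed
  have m_p: "1 < real N * I (p * \<alpha>)"
  proof -
    let ?\<beta> = "p * \<alpha>"
    have "(?\<beta> - \<gamma>) * I \<alpha> < (?\<beta> - \<alpha>) * I \<gamma> + (\<alpha> - \<gamma>) * I ?\<beta>"
      unfolding I_def using p_less nd exponents by (intro moment_strict_interpolation int_\<gamma> int') auto
    then have "real N * ((?\<beta> - \<gamma>) * I \<alpha>) < real N * ((?\<beta> - \<alpha>) * I \<gamma> + (\<alpha> - \<gamma>) * I ?\<beta>)"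
      using \<open>N > 1\<close> by (intro mult_strict_left_mono) auto
    also have "\<dots> = (?\<beta> - \<alpha>) * (real N * I \<gamma>) + (\<alpha> - \<gamma>) * (real N * I ?\<beta>)" by algebra
    also have "real N * ((?\<beta> - \<gamma>) * I \<alpha>) = (?\<beta> - \<gamma>) * (real N * I \<alpha>)" by algebra
    finally have "(\<alpha> - \<gamma>) * 1 < (\<alpha> - \<gamma>) * (real N * I ?\<beta>)"
      unfolding I_\<gamma> I_\<alpha> by simp
    then show ?thesis using exponents(2) by (simp add: mult_less_cancel_left_pos)
  qed
  obtain C t0 where tail: "0 < C" "\<And>t. t0 \<le> t \<Longrightarrow> C * t powr - \<alpha> \<le> \<P>(x in M'. t < \<bar>R x\<bar>)"
    using abs_tail_lower_bound[OF A_indep A_ident \<open>prob_space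
        M'\<close> R_rv R_solution R_nontrivial p _ b(2) int'
        m_b[unfolded I_def] I_\<alpha>[unfolded I_def] m_p[unfolded I_def]] b exponents by force
  have "Liminf at_top (\<lambda>t::real. ereal (t powr \<alpha> * \<P>(\<omega> in M'. R \<omega> > t))) > 0"
    by (rule right_tail_from_abs_tail[OF \<open>prob_space M'\<close> R_rv R_solution pos neg tail])
  moreover have "Liminf at_top (\<lambda>t::real. ereal (t powr \<alpha> * \<P>(\<omega> in M'. - R \<omega> > t))) > 0"
  proof (rule refl.right_tail_from_abs_tail[OF \<open>prob_space M'\<close> _ _ pos neg])
    show "(\<lambda>x. - R x) \<in> borel_measurable M'" using R_rv by simp
    show "smoothing_solution M N A (\<lambda>\<omega>. - B \<omega>) M' (\<lambda>x. - R x)"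
      by (rule smoothing_solution_uminus[OF coeff R_rv R_solution])
  qed (use tail in auto)
  moreover have "- R \<omega> > t \<longleftrightarrow> R \<omega> < - t" for \<omega> t by linarith
  ultimately show ?thesis by simp
qed

end
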